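(* For a Krasner hyperdomain $R$ and a prime hyperideal $P$ of $R$, let $\Theta$ be the set of all hypervaluation hyperideals of $R$, let $\Delta$ be the set of all $P$-primary hyperideals of $R$, and consider the assertion $(E)$: $\Delta\subseteq\Theta$ if and only if $\Delta$ is totally ordered by inclusion and $\bigcap_{Q\in\Delta}Q$ is a prime hyperideal of $R$. Suppose that $(E)$ holds for every local Krasner hyperdomain $R$ (and every prime hyperideal $P$ of $R$). Then $(E)$ holds for every (not necessarily local) Krasner hyperdomain $R$ (and every prime hyperideal $P$ of $R$).
   Context: A Krasner hyperring is a set $R$ with a hyperoperation $+$ (assigning to each pair $x,y$ a nonempty subset $x+y\subseteq R$) and a binary operation $\cdot$ such that: (1) $(R,+)$ is a canonical hypergroup: $+$ is associative and commutative, there is $0\in R$ with $0+x=\{x\}$ for all $x$, each $x$ has a unique opposite $-x$ with $0\in x+(-x)$, and $z\in x+y$ implies $y\in -x+z$ and $x\in z-y$; (2) $(R,\cdot)$ is a semigroup with $x\cdot 0=0\cdot x=0$; (3) $\cdot$ is distributive over $+$. Sums and products of subsets are taken as unions over elements, and $x-y=x+(-y)$. All hyperrings are commutative with unit element $1$. A hyperdomain is such a hyperring in which $ab=0$ implies $a=0$ or $b=0$; a hyperfield is one whose nonzero elements form a group under multiplication. A hyperideal of $R$ is a nonempty $I\subseteq R$ with $a-b\subseteq I$ and $ar\in I$ for all $a,b\in I$, $r\in R$. A proper hyperideal $P$ is prime if $ab\in P$ implies $a\in P$ or $b\in P$. The radical is $\sqrt{I}=\{x\in R: x^n\in I \text{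 for some positive integer } n\}$. A proper hyperideal $Q$ is primary if $xy\in Q$ implies $x\in Q$ or $y\in\sqrt{Q}$; it is $P$-primary if moreover $\sqrt{Q}=P$. A hyperring is local if it has a unique maximal hyperideal. For a Krasner hyperdomain $R$, $Q(R)$ is its quotient hyperfield (hyperfield of fractions): fractions $a/b$ with $b\ne 0$, usual equality and product, and $a/b+c/d=\{x/(bd): x\in ad+bc\}$; $R$ is regarded as a subset of $Q(R)$. A hypervaluation hyperring $V$ of $Q(R)$ is a subhyperring of $Q(R)$ such that for every nonzero $a\in Q(R)$, $a\in V$ or $a^{-1}\in V$. A hyperideal $I$ of $R$ is a hypervaluation hyperideal if there are a hypervaluation hyperring $V$ of $Q(R)$ containing $R$ and a hyperideal $J$ of $V$ with $I=J\cap R$. *)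

theory Defs
  imports "HOL-Algebra.Group"
begin

text \<open>
  Commutative Krasner hyperrings with unit, with explicit carriers. The multiplicative part is
  the HOL-Algebra \<open>monoid\<close> record, so products, units, inverses and powers are the library's.
\<close>

record 'a hyperring = "'a monoid" +
  hzero :: 'a (\<open>\<zero>\<^sub>h\<index>\<close>)
  hadd :: "['a, 'a] \<Rightarrow> 'a set" (infixl \<open>\<boxplus>\<index>\<close> 65)

definition hopp :: "('a, 'm) hyperring_scheme \<Rightarrow> 'a \<Rightarrow> 'a" (\<open>\<ominus>\<^sub>h\<index> _\<close> [81] 80)
  where "\<ominus>\<^sub>h\<^bsub>R\<^esub> x = (THE y. y \<in> carrier R \<and> \<zero>\<^sub>h\<^bsub>R\<^esub> \<in> x \<boxplus>\<^bsub>R\<^esub> y)"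

locale canonical_hypergroup =
  fixes R (structure)
  assumes hadd_closed: "\<lbrakk>x \<in> carrier R; y \<in> carrier R\<rbrakk> \<Longrightarrow> x \<boxplus> y \<subseteq> carrier R"
    and hadd_nonempty: "\<lbrakk>x \<in> carrier R; y \<in> carrier R\<rbrakk> \<Longrightarrow> x \<boxplus> y \<noteq> {}"
    and hadd_assoc: "\<lbrakk>x \<in> carrier R; y \<in> carrier R; z \<in> carrier R\<rbrakk>
          \<Longrightarrow> (\<Union>u\<in>x \<boxplus> y. u \<boxplus> z) = (\<Union>v\<in>y \<boxplus> z. x \<boxplus> v)"
    and hadd_comm: "\<lbrakk>x \<in> carrier R; y \<in> carrier R\<rbrakk> \<Longrightarrow> x \<boxplus> y = y \<boxplus> x"
    and hzero_closed: "\<zero>\<^sub>h \<in> carrier R"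
    and hadd_hzero: "x \<in> carrier R \<Longrightarrow> \<zero>\<^sub>h \<boxplus> x = {x}"
    and hopp_ex1: "x \<in> carrier R \<Longrightarrow> \<exists>!y. y \<in> carrier R \<and> \<zero>\<^sub>h \<in> x \<boxplus> y"
    and reversible: "\<lbrakk>x \<in> carrier R; y \<in> carrier R; z \<in> x \<boxplus> y\<rbrakk>
          \<Longrightarrow> y \<in> \<ominus>\<^sub>h x \<boxplus> z \<and> x \<in> z \<boxplus> \<ominus>\<^sub>h y"

locale krasner_hyperring = canonical_hypergroup R + comm_monoid R for R (structure) +
  assumes mult_hzero: "x \<in> carrier R \<Longrightarrow> x \<otimes> \<zero>\<^sub>h = \<zero>\<^sub>h"
    and distrib: "\<lbrakk>x \<in> carrier R; y \<in> carrier R; z \<in> carrier R\<rbrakk>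
          \<Longrightarrow> (\<lambda>u. x \<otimes> u) ` (y \<boxplus> z) = (x \<otimes> y) \<boxplus> (x \<otimes> z)"

locale krasner_hyperdomain = krasner_hyperring R for R (structure) +
  assumes integral: "\<lbrakk>a \<in> carrier R; b \<in> carrier R; a \<otimes> b = \<zero>\<^sub>h\<rbrakk> \<Longrightarrow> a = \<zero>\<^sub>h \<or> b = \<zero>\<^sub>h"

definition hyperideal :: "'a set \<Rightarrow> ('a, 'm) hyperring_scheme \<Rightarrow> bool"
  where "hyperideal I R \<longleftrightarrow>
    I \<subseteq> carrier R \<and> I \<noteq> {} \<and>
    (\<forall>a\<in>I. \<forall>b\<in>I. a \<boxplus>\<^bsub>R\<^esub> \<ominus>\<^sub>h\<^bsub>R\<^esub> b \<subseteq> I) \<and>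
    (\<forall>a\<in>I. \<forall>r\<in>carrier R. a \<otimes>\<^bsub>R\<^esub> r \<in> I)"

definition maximal_hyperideal :: "'a set \<Rightarrow> ('a, 'm) hyperring_scheme \<Rightarrow> bool"
  where "maximal_hyperideal M R \<longleftrightarrow>
    hyperideal M R \<and> M \<noteq> carrier R \<and>
    (\<forall>I. hyperideal I R \<and> I \<noteq> carrier R \<and> M \<subseteq> I \<longrightarrow> I = M)"

definition local_hyperring :: "('a, 'm) hyperring_scheme \<Rightarrow> bool"
  where "local_hyperring R \<longleftrightarrow> krasner_hyperring R \<and> (\<exists>!M. maximal_hyperideal M R)"

definition prime_hyperideal :: "'a set \<Rightarrow> ('a, 'm) hyperring_scheme \<Rightarrow> bool"
  where "prime_hyperideal P R \<longleftrightarrow>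
    hyperideal P R \<and> P \<noteq> carrier R \<and>
    (\<forall>a\<in>carrier R. \<forall>b\<in>carrier R. a \<otimes>\<^bsub>R\<^esub> b \<in> P \<longrightarrow> a \<in> P \<or> b \<in> P)"

definition hyperradical :: "('a, 'm) hyperring_scheme \<Rightarrow> 'a set \<Rightarrow> 'a set"
  where "hyperradical R I = {x \<in> carrier R. \<exists>n::nat. n > 0 \<and> x [^]\<^bsub>R\<^esub> n \<in> I}"

definition primary_hyperideal :: "'a set \<Rightarrow> ('a, 'm) hyperring_scheme \<Rightarrow> bool"
  where "primary_hyperideal Q R \<longleftrightarrow>
    hyperideal Q R \<and> Q \<noteq> carrier R \<and>
    (\<forall>x\<in>carrier R. \<forall>y\<in>carrier R. x \<otimes>\<^bsub>R\<^esub> y \<in> Q \<longrightarrow> x \<in> Q \<or> y \<in> hyperradical R Q)"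

definition primary_hyperideals_of :: "('a, 'm) hyperring_scheme \<Rightarrow> 'a set \<Rightarrow> 'a set set"
  where "primary_hyperideals_of R P = {Q. primary_hyperideal Q R \<and> hyperradical R Q = P}"

definition frac_rel :: "('a, 'm) hyperring_scheme \<Rightarrow> (('a \<times> 'a) \<times> ('a \<times> 'a)) set"
  where "frac_rel R = {((a, b), (c, d)).
    a \<in> carrier R \<and> b \<in> carrier R - {\<zero>\<^sub>h\<^bsub>R\<^esub>} \<and>
    c \<in> carrier R \<and> d \<in> carrier R - {\<zero>\<^sub>h\<^bsub>R\<^esub>} \<and> a \<otimes>\<^bsub>R\<^esub> d = b \<otimes>\<^bsub>R\<^esub> c}"

definition hfrac :: "('a, 'm) hyperring_scheme \<Rightarrow> 'a \<Rightarrow> 'a \<Rightarrow> ('a \<times> 'a) set"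
  where "hfrac R a b = frac_rel R `` {(a, b)}"

text \<open>
  Both operations range over all representatives of the two classes; the lemmas \<open>mult_hfrac\<close> and
  \<open>hadd_hfrac\<close> below show that over a hyperdomain the result is the one given by any single choice.
\<close>

definition quotient_hyperfield :: "('a, 'm) hyperring_scheme \<Rightarrow> ('a \<times> 'a) set hyperring"
  where "quotient_hyperfield R =
    \<lparr>carrier = (carrier R \<times> (carrier R - {\<zero>\<^sub>h\<^bsub>R\<^esub>})) // frac_rel R,
     mult = (\<lambda>X Y. \<Union>(a, b)\<in>X. \<Union>(c, d)\<in>Y. hfrac R (a \<otimes>\<^bsub>R\<^esub> c) (b \<otimes>\<^bsub>R\<^esub> d)),
     one = hfrac R \<one>\<^bsub>R\<^esub> \<one>\<^bsub>R\<^esub>,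
     hzero = hfrac R \<zero>\<^sub>h\<^bsub>R\<^esub> \<one>\<^bsub>R\<^esub>,
     hadd = (\<lambda>X Y. \<Union>(a, b)\<in>X. \<Union>(c, d)\<in>Y.
       (\<lambda>x. hfrac R x (b \<otimes>\<^bsub>R\<^esub> d)) ` ((a \<otimes>\<^bsub>R\<^esub> d) \<boxplus>\<^bsub>R\<^esub> (b \<otimes>\<^bsub>R\<^esub> c)))\<rparr>"

text \<open>The identification of \<open>R\<close> with a subset of its quotient hyperfield.\<close>

definition frac_embed :: "('a, 'm) hyperring_scheme \<Rightarrow> 'a \<Rightarrow> ('a \<times> 'a) set"
  where "frac_embed R a = hfrac R a \<one>\<^bsub>R\<^esub>"

definition subhyperring :: "'a set \<Rightarrow> ('a, 'm) hyperring_scheme \<Rightarrow> bool"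
  where "subhyperring S R \<longleftrightarrow> S \<subseteq> carrier R \<and> krasner_hyperring (R\<lparr>carrier := S\<rparr>)"

definition hypervaluation_hyperring :: "'a set \<Rightarrow> ('a, 'm) hyperring_scheme \<Rightarrow> bool"
  where "hypervaluation_hyperring V K \<longleftrightarrow>
    subhyperring V K \<and>
    (\<forall>a\<in>carrier K. a \<noteq> \<zero>\<^sub>h\<^bsub>K\<^esub> \<longrightarrow> a \<in> V \<or> inv\<^bsub>K\<^esub> a \<in> V)"

definition hypervaluation_hyperideal :: "'a set \<Rightarrow> ('a, 'm) hyperring_scheme \<Rightarrow> bool"
  where "hypervaluation_hyperideal I R \<longleftrightarrow>
    hyperideal I R \<and>
    (\<exists>V J. hypervaluation_hyperring V (quotient_hyperfield R) \<and>
       frac_embed R ` carrier R \<subseteq> V \<and>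
       hyperideal J ((quotient_hyperfield R)\<lparr>carrier := V\<rparr>) \<and>
       frac_embed R ` I = J \<inter> frac_embed R ` carrier R)"

definition hypervaluation_hyperideals :: "('a, 'm) hyperring_scheme \<Rightarrow> 'a set set"
  where "hypervaluation_hyperideals R = {I. hypervaluation_hyperideal I R}"

definition assertion_E :: "('a, 'm) hyperring_scheme \<Rightarrow> 'a set \<Rightarrow> bool"
  where "assertion_E R P \<longleftrightarrow>
    (let \<Theta> = hypervaluation_hyperideals R; \<Delta> = primary_hyperideals_of R P in
      \<Delta> \<subseteq> \<Theta> \<longleftrightarrow>
      (\<forall>A\<in>\<Delta>. \<forall>B\<in>\<Delta>. A \<subseteq> B \<or> B \<subseteq> A) \<and> prime_hyperideal (\<Inter>Q\<in>\<Delta>. Q) R)"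

context krasner_hyperdomain
begin

lemma hyperdomain_cancel:
  assumes a: "a \<in> carrier R" "a \<noteq> \<zero>\<^sub>h" and b: "b \<in> carrier R" and c: "c \<in> carrier R"
    and eq: "a \<otimes> b = a \<otimes> c"
  shows "b = c"
proof -
  obtain b' where b': "b' \<in> carrier R" "\<zero>\<^sub>h \<in> b \<boxplus> b'"
    using hopp_ex1[OF b] by blast
  have "a \<otimes> \<zero>\<^sub>h \<in> (\<lambda>u. a \<otimes> u) ` (b \<boxplus> b')"
    using b'(2) by blast
  hence "\<zero>\<^sub>h \<in> (\<lambda>u. a \<otimes> u) ` (c \<boxplus> b')"
    using a b c b' eq by (simp add: distrib mult_hzero)
  then obtain u where u: "u \<in> c \<boxplus> b'" "a \<otimes> u = \<zero>\<^sub>h"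
    by force
  have "u \<in> carrier R"
    using hadd_closed[OF c b'(1)] u(1) by blast
  hence "\<zero>\<^sub>h \<in> c \<boxplus> b'"
    using integral[OF a(1) _ u(2)] a(2) u(1) by blast
  thus ?thesis
    using b' b c hopp_ex1[OF b'(1)] hadd_comm by metis
qed

lemma equiv_frac_rel: "equiv (carrier R \<times> (carrier R - {\<zero>\<^sub>h})) (frac_rel R)"
proof (rule equivI)
  show "frac_rel R \<subseteq> (carrier R \<times> (carrier R - {\<zero>\<^sub>h})) \<times> (carrier R \<times> (carrier R - {\<zero>\<^sub>h}))"
    by (auto simp: frac_rel_def)
  show "refl_on (carrier R \<times> (carrier R - {\<zero>\<^sub>h})) (frac_rel R)"
    by (auto simp: refl_on_def frac_rel_def m_comm)
  show "sym (frac_rel R)"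
    by (auto simp: sym_def frac_rel_def m_comm)
  show "trans (frac_rel R)"
  proof (rule transI)
    fix x y z assume xy: "(x, y) \<in> frac_rel R" and yz: "(y, z) \<in> frac_rel R"
    obtain a b c d e f where [simp]: "x = (a, b)" "y = (c, d)" "z = (e, f)"
      by (metis surj_pair)
    have mem: "a \<in> carrier R" "b \<in> carrier R" "c \<in> carrier R" "d \<in> carrier R"
        "e \<in> carrier R" "f \<in> carrier R" "b \<noteq> \<zero>\<^sub>h" "d \<noteq> \<zero>\<^sub>h" "f \<noteq> \<zero>\<^sub>h"
      and eqs: "a \<otimes> d = b \<otimes> c" "c \<otimes> f = d \<otimes> e"
      using xy yz by (auto simp: frac_rel_def)
    have "d \<otimes> (a \<otimes> f) = (a \<otimes> d) \<otimes> f"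
      using mem by (simp add: m_ac)
    also have "\<dots> = b \<otimes> (c \<otimes> f)"
      using mem by (simp add: eqs(1) m_assoc)
    also have "\<dots> = d \<otimes> (b \<otimes> e)"
      using mem by (simp add: eqs(2) m_lcomm)
    finally have "a \<otimes> f = b \<otimes> e"
      using hyperdomain_cancel[of d "a \<otimes> f" "b \<otimes> e"] mem by simp
    thus "(x, z) \<in> frac_rel R"
      using mem by (simp add: frac_rel_def)
  qed
qed

lemma hfrac_eq_iff:
  assumes "a \<in> carrier R" "b \<in> carrier R - {\<zero>\<^sub>h}" "c \<in> carrier R" "d \<in> carrier R - {\<zero>\<^sub>h}"
  shows "hfrac R a b = hfrac R c d \<longleftrightarrow> a \<otimes> d = b \<otimes> c"
  using eq_equiv_class_iff[OF equiv_frac_rel, of "(a, b)" "(c, d)"] assms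
  by (auto simp: hfrac_def frac_rel_def)

lemma mem_hfrac:
  "(a', b') \<in> hfrac R a b \<longleftrightarrow>
    a \<in> carrier R \<and> b \<in> carrier R - {\<zero>\<^sub>h} \<and>
    a' \<in> carrier R \<and> b' \<in> carrier R - {\<zero>\<^sub>h} \<and> a \<otimes> b' = b \<otimes> a'"
  by (auto simp: hfrac_def frac_rel_def)

lemma denom_closed:
  "\<lbrakk>b \<in> carrier R - {\<zero>\<^sub>h}; d \<in> carrier R - {\<zero>\<^sub>h}\<rbrakk> \<Longrightarrow> b \<otimes> d \<in> carrier R - {\<zero>\<^sub>h}"
  using integral by auto

lemma self_mem_hfrac:
  "\<lbrakk>a \<in> carrier R; b \<in> carrier R - {\<zero>\<^sub>h}\<rbrakk> \<Longrightarrow> (a, b) \<in> hfrac R a b"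
  by (simp add: mem_hfrac m_comm)

lemma mult_hfrac:
  assumes "a \<in> carrier R" "b \<in> carrier R - {\<zero>\<^sub>h}" "c \<in> carrier R" "d \<in> carrier R - {\<zero>\<^sub>h}"
  shows "hfrac R a b \<otimes>\<^bsub>quotient_hyperfield R\<^esub> hfrac R c d = hfrac R (a \<otimes> c) (b \<otimes> d)"
proof -
  have eq: "hfrac R (a' \<otimes> c') (b' \<otimes> d') = hfrac R (a \<otimes> c) (b \<otimes> d)"
    if m: "(a', b') \<in> hfrac R a b" "(c', d') \<in> hfrac R c d" for a' b' c' d'
  proof -
    have mem: "a' \<in> carrier R" "b' \<in> carrier R - {\<zero>\<^sub>h}" "c' \<in> carrier R" "d' \<in> carrier R - {\<zero>\<^sub>h}"
      and e: "a \<otimes> b' = b \<otimes> a'" "c \<otimes> d' = d \<otimes> c'"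
      using m by (auto simp: mem_hfrac)
    have "(a' \<otimes> c') \<otimes> (b \<otimes> d) = (b \<otimes> a') \<otimes> (d \<otimes> c')"
      using mem assms by (simp add: m_ac)
    also have "\<dots> = (a \<otimes> b') \<otimes> (c \<otimes> d')"
      by (simp add: e)
    also have "\<dots> = (b' \<otimes> d') \<otimes> (a \<otimes> c)"
      using mem assms by (simp add: m_ac)
    finally show ?thesis
      using mem assms denom_closed by (simp add: hfrac_eq_iff del: Diff_iff)
  qed
  have "(\<Union>(a', b')\<in>hfrac R a b. \<Union>(c', d')\<in>hfrac R c d. hfrac R (a' \<otimes> c') (b' \<otimes> d'))
      = hfrac R (a \<otimes> c) (b \<otimes> d)" (is "?L = ?R")
  proof
    show "?L \<subseteq> ?R"
    proof
      fix z assume "z \<in> ?L"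
      then obtain a' b' c' d' where "(a', b') \<in> hfrac R a b" "(c', d') \<in> hfrac R c d"
        "z \<in> hfrac R (a' \<otimes> c') (b' \<otimes> d')"
        by blast
      thus "z \<in> ?R"
        using eq by blast
    qed
    show "?R \<subseteq> ?L"
      using self_mem_hfrac[OF assms(1,2)] self_mem_hfrac[OF assms(3,4)] by blast
  qed
  thus ?thesis
    by (simp add: quotient_hyperfield_def)
qed

lemma hadd_hfrac:
  assumes abcd: "a \<in> carrier R" "b \<in> carrier R - {\<zero>\<^sub>h}" "c \<in> carrier R" "d \<in> carrier R - {\<zero>\<^sub>h}"
  shows "hfrac R a b \<boxplus>\<^bsub>quotient_hyperfield R\<^esub> hfrac R c d
    = {hfrac R x (b \<otimes> d) | x. x \<in> (a \<otimes> d) \<boxplus> (b \<otimes> c)}"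
proof -
  have ex: "\<exists>y\<in>(a \<otimes> d) \<boxplus> (b \<otimes> c). hfrac R x (b' \<otimes> d') = hfrac R y (b \<otimes> d)"
    if m: "(a', b') \<in> hfrac R a b" "(c', d') \<in> hfrac R c d"
      and x: "x \<in> (a' \<otimes> d') \<boxplus> (b' \<otimes> c')" for a' b' c' d' x
  proof -
    have mem: "a' \<in> carrier R" "b' \<in> carrier R - {\<zero>\<^sub>h}" "c' \<in> carrier R" "d' \<in> carrier R - {\<zero>\<^sub>h}"
      and e: "a \<otimes> b' = b \<otimes> a'" "c \<otimes> d' = d \<otimes> c'"
      using m by (auto simp: mem_hfrac)
    have "(b \<otimes> d) \<otimes> x \<in> (\<lambda>u. (b \<otimes> d) \<otimes> u) ` ((a' \<otimes> d') \<boxplus> (b' \<otimes> c'))"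
      using x by blast
    also have "\<dots> = ((b \<otimes> d) \<otimes> (a' \<otimes> d')) \<boxplus> ((b \<otimes> d) \<otimes> (b' \<otimes> c'))"
      using mem abcd by (simp add: distrib)
    also have "(b \<otimes> d) \<otimes> (a' \<otimes> d') = (b \<otimes> a') \<otimes> (d \<otimes> d')"
      using mem abcd by (simp add: m_ac)
    also have "\<dots> = (b' \<otimes> d') \<otimes> (a \<otimes> d)"
      unfolding e(1)[symmetric] using mem abcd by (simp add: m_ac)
    also have "(b \<otimes> d) \<otimes> (b' \<otimes> c') = (b \<otimes> b') \<otimes> (d \<otimes> c')"
      using mem abcd by (simp add: m_ac)
    also have "\<dots> = (b' \<otimes> d') \<otimes> (b \<otimes> c)"
      unfolding e(2)[symmetric] using mem abcd by (simp add: m_ac)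
    also have "((b' \<otimes> d') \<otimes> (a \<otimes> d)) \<boxplus> ((b' \<otimes> d') \<otimes> (b \<otimes> c))
        = (\<lambda>u. (b' \<otimes> d') \<otimes> u) ` ((a \<otimes> d) \<boxplus> (b \<otimes> c))"
      using mem abcd by (simp add: distrib)
    finally obtain y where y: "y \<in> (a \<otimes> d) \<boxplus> (b \<otimes> c)" "(b \<otimes> d) \<otimes> x = (b' \<otimes> d') \<otimes> y"
      by blast
    have "x \<in> carrier R" "y \<in> carrier R"
      using x y(1) hadd_closed[of "a' \<otimes> d'" "b' \<otimes> c'"] hadd_closed[of "a \<otimes> d" "b \<otimes> c"] mem abcd
      by auto
    moreover from this have "x \<otimes> (b \<otimes> d) = (b' \<otimes> d') \<otimes> y"
      using y(2) abcd by (simp add: m_comm)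
    ultimately have "hfrac R x (b' \<otimes> d') = hfrac R y (b \<otimes> d)"
      using denom_closed[OF mem(2,4)] denom_closed[OF abcd(2,4)] hfrac_eq_iff by blast
    thus ?thesis
      using y(1) by blast
  qed
  have "(\<Union>(a', b')\<in>hfrac R a b. \<Union>(c', d')\<in>hfrac R c d.
        (\<lambda>x. hfrac R x (b' \<otimes> d')) ` ((a' \<otimes> d') \<boxplus> (b' \<otimes> c')))
      = {hfrac R x (b \<otimes> d) | x. x \<in> (a \<otimes> d) \<boxplus> (b \<otimes> c)}" (is "?L = ?R")
  proof
    show "?L \<subseteq> ?R"
      using ex by fast
    show "?R \<subseteq> ?L"
      using self_mem_hfrac[OF abcd(1,2)] self_mem_hfrac[OF abcd(3,4)] by fast
  qed
  thus ?thesis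
    by (simp add: quotient_hyperfield_def)
qed

end

end

theory Submission
  imports Defs
begin

text \<open>
  The proof localizes at \<open>P\<close>. Let \<open>S\<close> be the localization of \<open>R\<close> at \<open>P\<close> and \<open>P'\<close> the extension of \<open>P\<close>,
  which is the unique maximal hyperideal of \<open>S\<close>. The assertion for \<open>(R, P)\<close> is equivalent to the
  assertion for \<open>(S, P')\<close> (lemma \<open>assertion_E_iff\<close>), and the latter is an instance of the hypothesis.

  The equivalence has two parts. Contraction is an order isomorphism from the \<open>P'\<close>-primary hyperideals
  of \<open>S\<close> to the \<open>P\<close>-primary hyperideals of \<open>R\<close> (\<open>primary_hyperideals_of_eq\<close>, \<open>contr_mono_iff\<close>); it commutes
  with intersections, and a hyperideal of \<open>S\<close> is prime exactly when its contraction is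
  (\<open>prime_contr_iff\<close>). This settles the condition on chains and intersections. Moreover a \<open>P'\<close>-primary
  hyperideal is a hypervaluation hyperideal of \<open>S\<close> exactly when its contraction is one of \<open>R\<close>
  (\<open>contr_hypervaluation_iff\<close>): the two quotient hyperfields are isomorphic, a hypervaluation hyperring
  containing \<open>S\<close> contains \<open>R\<close>, and one that contains \<open>R\<close> can be enlarged to contain \<open>S\<close> by inverting the
  complement of \<open>P\<close>, which leaves the contraction unchanged because the hyperideal is \<open>P\<close>-primary
  (\<open>valuation_contraction_ext\<close>).

  The hypothesis speaks about hyperrings over one type, whereas the localization consists of sets of
  pairs. If \<open>R\<close> is infinite, then it is equipotent to \<open>R \<times> R\<close>, and an isomorphic copy of the localization
  lives on a subset of \<open>R\<close> (\<open>localization_exists\<close>). If \<open>R\<close> is finite, it is a hyperfield and hence already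
  local (\<open>local_if_finite\<close>).
\<close>

section \<open>Krasner hyperrings and their hyperideals\<close>

text \<open>
  A criterion for Krasner hyperrings that does not mention \<open>hopp\<close>: reversibility is stated for every
  element \<open>x'\<close> with \<open>\<zero>\<^sub>h \<in> x \<boxplus> x'\<close>. Uniqueness of opposites need not be assumed, as it is the case
  \<open>z = \<zero>\<^sub>h\<close> of reversibility. This form passes to images and subsets without computing \<open>hopp\<close> there.
\<close>

lemma krasner_hyperringI:
  fixes R (structure)
  assumes closed: "\<And>x y. \<lbrakk>x \<in> carrier R; y \<in> carrier R\<rbrakk> \<Longrightarrow> x \<boxplus> y \<subseteq> carrier R"
    and nonempty: "\<And>x y. \<lbrakk>x \<in> carrier R; y \<in> carrier R\<rbrakk> \<Longrightarrow> x \<boxplus> y \<noteq> {}"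
    and assoc: "\<And>x y z. \<lbrakk>x \<in> carrier R; y \<in> carrier R; z \<in> carrier R\<rbrakk>
          \<Longrightarrow> (\<Union>u\<in>x \<boxplus> y. u \<boxplus> z) = (\<Union>v\<in>y \<boxplus> z. x \<boxplus> v)"
    and comm: "\<And>x y. \<lbrakk>x \<in> carrier R; y \<in> carrier R\<rbrakk> \<Longrightarrow> x \<boxplus> y = y \<boxplus> x"
    and zero: "\<zero>\<^sub>h \<in> carrier R"
    and zero_add: "\<And>x. x \<in> carrier R \<Longrightarrow> \<zero>\<^sub>h \<boxplus> x = {x}"
    and opp: "\<And>x. x \<in> carrier R \<Longrightarrow> \<exists>y\<in>carrier R. \<zero>\<^sub>h \<in> x \<boxplus> y"
    and rev: "\<And>x x' y z. \<lbrakk>x \<in> carrier R; x' \<in> carrier R; y \<in> carrier R;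
          \<zero>\<^sub>h \<in> x \<boxplus> x'; z \<in> x \<boxplus> y\<rbrakk> \<Longrightarrow> y \<in> x' \<boxplus> z"
    and monoid: "comm_monoid R"
    and mult_zero: "\<And>x. x \<in> carrier R \<Longrightarrow> x \<otimes> \<zero>\<^sub>h = \<zero>\<^sub>h"
    and dist: "\<And>x y z. \<lbrakk>x \<in> carrier R; y \<in> carrier R; z \<in> carrier R\<rbrakk>
          \<Longrightarrow> (\<lambda>u. x \<otimes> u) ` (y \<boxplus> z) = (x \<otimes> y) \<boxplus> (x \<otimes> z)"
  shows "krasner_hyperring R"
proof -
  have ex1: "\<exists>!y. y \<in> carrier R \<and> \<zero>\<^sub>h \<in> x \<boxplus> y" if x: "x \<in> carrier R" for x
  proof -
    have "y = y'" if y: "y \<in> carrier R" "\<zero>\<^sub>h \<in> x \<boxplus> y" and y': "y' \<in> carrier R" "\<zero>\<^sub>h \<in> x \<boxplus> y'"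
      for y y'
      using rev[OF x y'(1) y(1) y'(2) y(2)] comm[OF y'(1) zero] zero_add[OF y'(1)] by simp
    thus ?thesis
      using opp[OF x] by blast
  qed
  have hopp: "\<ominus>\<^sub>h x \<in> carrier R \<and> \<zero>\<^sub>h \<in> x \<boxplus> \<ominus>\<^sub>h x" if "x \<in> carrier R" for x
    unfolding hopp_def by (rule theI'[OF ex1[OF that]])
  have rev': "y \<in> \<ominus>\<^sub>h x \<boxplus> z \<and> x \<in> z \<boxplus> \<ominus>\<^sub>h y"
    if x: "x \<in> carrier R" and y: "y \<in> carrier R" and z: "z \<in> x \<boxplus> y" for x y z
  proof -
    have zc: "z \<in> carrier R"
      using closed[OF x y] z by blast
    have "x \<in> \<ominus>\<^sub>h y \<boxplus> z"
      using rev[of y "\<ominus>\<^sub>h y" x z] hopp[OF y] x y z comm by blast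
    thus ?thesis
      using rev[of x "\<ominus>\<^sub>h x" y z] hopp[OF x] hopp[OF y] x y z zc comm by blast
  qed
  show ?thesis
    unfolding krasner_hyperring_def
    by (intro conjI canonical_hypergroup.intro krasner_hyperring_axioms.intro monoid)
      (use closed nonempty assoc comm zero zero_add ex1 rev' mult_zero dist in auto)
qed

context krasner_hyperring
begin

lemma hopp_closed: "x \<in> carrier R \<Longrightarrow> \<ominus>\<^sub>h x \<in> carrier R"
  and hadd_hopp: "x \<in> carrier R \<Longrightarrow> \<zero>\<^sub>h \<in> x \<boxplus> \<ominus>\<^sub>h x"
  using theI'[OF hopp_ex1, of x] by (simp_all add: hopp_def)

lemma hopp_unique: "\<lbrakk>x \<in> carrier R; y \<in> carrier R; \<zero>\<^sub>h \<in> x \<boxplus> y\<rbrakk> \<Longrightarrow> y = \<ominus>\<^sub>h x"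
  using hopp_ex1[of x] hopp_closed[of x] hadd_hopp[of x] by blast

lemma hopp_hopp: "x \<in> carrier R \<Longrightarrow> \<ominus>\<^sub>h (\<ominus>\<^sub>h x) = x"
  using hopp_unique[of "\<ominus>\<^sub>h x" x] hopp_closed[of x] hadd_hopp[of x] hadd_comm[of x "\<ominus>\<^sub>h x"] by simp

lemma reversible_opp:
  assumes "x \<in> carrier R" "x' \<in> carrier R" "y \<in> carrier R" "\<zero>\<^sub>h \<in> x \<boxplus> x'" "z \<in> x \<boxplus> y"
  shows "y \<in> x' \<boxplus> z"
  using reversible[of x y z] hopp_unique[of x x'] assms by simp

lemma mult_hopp:
  assumes "x \<in> carrier R" "y \<in> carrier R"
  shows "x \<otimes> \<ominus>\<^sub>h y = \<ominus>\<^sub>h (x \<otimes> y)"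
proof -
  have "x \<otimes> \<zero>\<^sub>h \<in> (\<lambda>u. x \<otimes> u) ` (y \<boxplus> \<ominus>\<^sub>h y)"
    using hadd_hopp assms by blast
  thus ?thesis
    using assms hopp_closed by (intro hopp_unique) (auto simp: distrib mult_hzero)
qed

lemma hopp_eq_mult: "x \<in> carrier R \<Longrightarrow> \<ominus>\<^sub>h x = x \<otimes> \<ominus>\<^sub>h \<one>"
  by (simp add: mult_hopp)

text \<open>
  Since \<open>\<ominus>\<^sub>h x = x \<otimes> \<ominus>\<^sub>h \<one>\<close>, an absorbing set contains the opposites of its elements, so closure
  under differences can be replaced by closure under sums.
\<close>

lemma hyperideal_iff:
  "hyperideal I R \<longleftrightarrow> I \<subseteq> carrier R \<and> I \<noteq> {} \<and> (\<forall>a\<in>I. \<forall>b\<in>I. a \<boxplus> b \<subseteq> I) \<and>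
    (\<forall>a\<in>I. \<forall>r\<in>carrier R. a \<otimes> r \<in> I)"
proof -
  have "(\<forall>a\<in>I. \<forall>b\<in>I. a \<boxplus> \<ominus>\<^sub>h b \<subseteq> I) \<longleftrightarrow> (\<forall>a\<in>I. \<forall>b\<in>I. a \<boxplus> b \<subseteq> I)"
    if I: "I \<subseteq> carrier R" "\<forall>a\<in>I. \<forall>r\<in>carrier R. a \<otimes> r \<in> I"
  proof -
    have opp: "\<ominus>\<^sub>h a \<in> I" if "a \<in> I" for a
      using that I hopp_eq_mult[of a] hopp_closed[OF one_closed] by auto
    have opp_opp: "\<ominus>\<^sub>h (\<ominus>\<^sub>h a) = a" if "a \<in> I" for a
      using that I hopp_hopp by blast
    show ?thesis
    proof (intro iffI ballI)
      fix a b assume "\<forall>a\<in>I. \<forall>b\<in>I. a \<boxplus> \<ominus>\<^sub>h b \<subseteq> I" "a \<in> I" "b \<in> I"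
      thus "a \<boxplus> b \<subseteq> I"
        using opp[of b] opp_opp[of b] by fastforce
    qed (use opp in blast)
  qed
  thus ?thesis
    unfolding hyperideal_def by blast
qed

lemma hyperidealD:
  assumes "hyperideal I R"
  shows "I \<subseteq> carrier R" "\<And>a b. \<lbrakk>a \<in> I; b \<in> I\<rbrakk> \<Longrightarrow> a \<boxplus> b \<subseteq> I"
    "\<And>a r. \<lbrakk>a \<in> I; r \<in> carrier R\<rbrakk> \<Longrightarrow> a \<otimes> r \<in> I" "\<zero>\<^sub>h \<in> I"
proof -
  show I: "I \<subseteq> carrier R" "\<And>a b. \<lbrakk>a \<in> I; b \<in> I\<rbrakk> \<Longrightarrow> a \<boxplus> b \<subseteq> I"
    "\<And>a r. \<lbrakk>a \<in> I; r \<in> carrier R\<rbrakk> \<Longrightarrow> a \<otimes> r \<in> I"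
    using assms by (auto simp: hyperideal_iff)
  obtain a where "a \<in> I"
    using assms by (auto simp: hyperideal_iff)
  thus "\<zero>\<^sub>h \<in> I"
    using I(1) I(3)[of a "\<zero>\<^sub>h"] mult_hzero hzero_closed by auto
qed

lemma hyperideal_one: "\<lbrakk>hyperideal I R; \<one> \<in> I\<rbrakk> \<Longrightarrow> I = carrier R"
  using hyperidealD(1,3)[of I] hyperidealD(3)[of I \<one>] by force

lemma hyperideal_mult_unit_iff:
  assumes "hyperideal I R" "x \<in> carrier R" "u \<in> carrier R" "v \<in> carrier R" "u \<otimes> v = \<one>"
  shows "x \<otimes> u \<in> I \<longleftrightarrow> x \<in> I"
  using hyperidealD(3)[OF assms(1), of "x \<otimes> u" v] hyperidealD(3)[OF assms(1), of x u] assms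
  by (auto simp: m_assoc)

lemma hyperideal_Inter:
  assumes "\<And>I. I \<in> \<I> \<Longrightarrow> hyperideal I R" "\<I> \<noteq> {}"
  shows "hyperideal (\<Inter>I\<in>\<I>. I) R"
proof -
  note I = hyperidealD[OF assms(1)]
  have "\<zero>\<^sub>h \<in> (\<Inter>I\<in>\<I>. I)"
    using I(4) by simp
  moreover have "(\<Inter>I\<in>\<I>. I) \<subseteq> carrier R"
  proof -
    obtain I where "I \<in> \<I>"
      using assms(2) by blast
    with I(1)[OF this] show ?thesis
      by auto
  qed
  moreover have "a \<boxplus> b \<subseteq> (\<Inter>I\<in>\<I>. I)" if "a \<in> (\<Inter>I\<in>\<I>. I)" "b \<in> (\<Inter>I\<in>\<I>. I)" for a b
    using that by (intro INT_greatest I(2)) auto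
  moreover have "a \<otimes> r \<in> (\<Inter>I\<in>\<I>. I)" if "a \<in> (\<Inter>I\<in>\<I>. I)" "r \<in> carrier R" for a r
    using that by (intro INT_I I(3)) auto
  ultimately show ?thesis
    unfolding hyperideal_iff by (metis empty_iff)
qed

lemma prime_hyperidealD:
  assumes "prime_hyperideal P R"
  shows "hyperideal P R" "P \<subseteq> carrier R" "\<zero>\<^sub>h \<in> P" "\<one> \<notin> P"
    "\<And>a b. \<lbrakk>a \<in> carrier R; b \<in> carrier R; a \<otimes> b \<in> P\<rbrakk> \<Longrightarrow> a \<in> P \<or> b \<in> P"
proof -
  show P: "hyperideal P R"
    using assms by (simp add: prime_hyperideal_def)
  show "P \<subseteq> carrier R" "\<zero>\<^sub>h \<in> P"
    using hyperidealD(1,4)[OF P] .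
  show "\<one> \<notin> P" "\<And>a b. \<lbrakk>a \<in> carrier R; b \<in> carrier R; a \<otimes> b \<in> P\<rbrakk> \<Longrightarrow> a \<in> P \<or> b \<in> P"
    using assms hyperideal_one[OF P] by (auto simp: prime_hyperideal_def)
qed

lemma nat_pow_mem_prime:
  assumes P: "prime_hyperideal P R" and x: "x \<in> carrier R" and n: "x [^] (n::nat) \<in> P"
  shows "x \<in> P"
  using n prime_hyperidealD(4)[OF P] prime_hyperidealD(5)[OF P _ x] x by (induction n) auto

lemma hyperradical_prime: "prime_hyperideal P R \<Longrightarrow> hyperradical R P = P"
  using prime_hyperidealD(2)[of P] nat_pow_mem_prime[of P]
  by (auto simp: hyperradical_def subset_iff intro!: exI[of _ "1::nat"])

lemma prime_mem_primary_hyperideals_of: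
  "prime_hyperideal P R \<Longrightarrow> P \<in> primary_hyperideals_of R P"
  by (simp add: primary_hyperideals_of_def primary_hyperideal_def hyperradical_prime)
    (simp add: prime_hyperideal_def)

end

section \<open>Embeddings and subhyperrings\<close>

text \<open>
  Injective homomorphisms that are strong: the image of a sum is the whole sum of the images, not
  only a subset of it. All conditions are restricted to the carrier of the source.
\<close>

definition hyperring_embedding ::
    "('a \<Rightarrow> 'b) \<Rightarrow> ('a, 'm) hyperring_scheme \<Rightarrow> ('b, 'n) hyperring_scheme \<Rightarrow> bool"
  where "hyperring_embedding \<phi> R S \<longleftrightarrow>
    inj_on \<phi> (carrier R) \<and> \<phi> ` carrier R \<subseteq> carrier S \<and>
    \<phi> \<one>\<^bsub>R\<^esub> = \<one>\<^bsub>S\<^esub> \<and> \<phi> \<zero>\<^sub>h\<^bsub>R\<^esub> = \<zero>\<^sub>h\<^bsub>S\<^esub> \<and>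
    (\<forall>x\<in>carrier R. \<forall>y\<in>carrier R. \<phi> (x \<otimes>\<^bsub>R\<^esub> y) = \<phi> x \<otimes>\<^bsub>S\<^esub> \<phi> y) \<and>
    (\<forall>x\<in>carrier R. \<forall>y\<in>carrier R. \<phi> ` (x \<boxplus>\<^bsub>R\<^esub> y) = \<phi> x \<boxplus>\<^bsub>S\<^esub> \<phi> y)"

lemma hyperring_embeddingD:
  assumes "hyperring_embedding \<phi> R S"
  shows "inj_on \<phi> (carrier R)" "\<And>x. x \<in> carrier R \<Longrightarrow> \<phi> x \<in> carrier S"
    "\<phi> \<one>\<^bsub>R\<^esub> = \<one>\<^bsub>S\<^esub>" "\<phi> \<zero>\<^sub>h\<^bsub>R\<^esub> = \<zero>\<^sub>h\<^bsub>S\<^esub>"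
    "\<And>x y. \<lbrakk>x \<in> carrier R; y \<in> carrier R\<rbrakk> \<Longrightarrow> \<phi> (x \<otimes>\<^bsub>R\<^esub> y) = \<phi> x \<otimes>\<^bsub>S\<^esub> \<phi> y"
    "\<And>x y. \<lbrakk>x \<in> carrier R; y \<in> carrier R\<rbrakk> \<Longrightarrow> \<phi> ` (x \<boxplus>\<^bsub>R\<^esub> y) = \<phi> x \<boxplus>\<^bsub>S\<^esub> \<phi> y"
  using assms by (auto simp: hyperring_embedding_def)

lemma hyperring_embedding_comp:
  assumes "hyperring_embedding \<phi> R S" "hyperring_embedding \<psi> S T"
  shows "hyperring_embedding (\<psi> \<circ> \<phi>) R T"
proof -
  note \<phi> = hyperring_embeddingD[OF assms(1)] and \<psi> = hyperring_embeddingD[OF assms(2)]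
  have "inj_on (\<psi> \<circ> \<phi>) (carrier R)"
    using \<phi>(1,2) \<psi>(1) by (intro comp_inj_on) (auto intro: inj_on_subset)
  moreover have "(\<psi> \<circ> \<phi>) ` (x \<boxplus>\<^bsub>R\<^esub> y) = (\<psi> \<circ> \<phi>) x \<boxplus>\<^bsub>T\<^esub> (\<psi> \<circ> \<phi>) y"
    if "x \<in> carrier R" "y \<in> carrier R" for x y
    using \<phi>(2) that by (simp add: \<phi>(6)[symmetric] \<psi>(6)[symmetric] image_comp)
  ultimately show ?thesis
    unfolding hyperring_embedding_def using \<phi>(2,3,4,5) \<psi>(2,3,4,5) by auto
qed

text \<open>
  Transport of structure along a strong isomorphism; the target is not assumed to be a hyperring.
\<close>

lemma krasner_hyperring_image:
  fixes R (structure) and S (structure)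
  assumes R: "krasner_hyperring R" and emb: "hyperring_embedding \<phi> R S"
    and surj: "carrier S = \<phi> ` carrier R"
  shows "krasner_hyperring S"
proof -
  interpret R: krasner_hyperring R by fact
  note \<phi> = hyperring_embeddingD[OF emb]
  note sums = \<phi>(6)[symmetric]
  have refl: "\<zero>\<^sub>h\<^bsub>S\<^esub> \<in> \<phi> x \<boxplus>\<^bsub>S\<^esub> \<phi> y \<Longrightarrow> \<zero>\<^sub>h \<in> x \<boxplus> y" if xy: "x \<in> carrier R" "y \<in> carrier R" for x y
  proof -
    assume "\<zero>\<^sub>h\<^bsub>S\<^esub> \<in> \<phi> x \<boxplus>\<^bsub>S\<^esub> \<phi> y"
    then obtain z where "z \<in> x \<boxplus> y" "\<phi> z = \<phi> \<zero>\<^sub>h"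
      using xy \<phi>(4) by (auto simp: sums)
    thus ?thesis
      using \<phi>(1) R.hzero_closed R.hadd_closed[OF xy] by (metis inj_onD subsetD)
  qed
  show ?thesis
  proof (rule krasner_hyperringI, goal_cases)
    case (1 x y) thus ?case
      using R.hadd_closed by (fastforce simp: surj sums)
  next
    case (2 x y) thus ?case
      using R.hadd_nonempty by (auto simp: surj sums)
  next
    case (3 x y z)
    then obtain a b c where abc: "a \<in> carrier R" "b \<in> carrier R" "c \<in> carrier R"
      "x = \<phi> a" "y = \<phi> b" "z = \<phi> c"
      by (auto simp: surj)
    have "(\<Union>u\<in>x \<boxplus>\<^bsub>S\<^esub> y. u \<boxplus>\<^bsub>S\<^esub> z) = (\<Union>u\<in>a \<boxplus> b. \<phi> u \<boxplus>\<^bsub>S\<^esub> \<phi> c)"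
      using abc by (simp add: sums)
    also have "\<dots> = (\<Union>u\<in>a \<boxplus> b. \<phi> ` (u \<boxplus> c))"
      using abc R.hadd_closed[of a b] by (intro SUP_cong) (auto simp: sums)
    also have "\<dots> = \<phi> ` (\<Union>v\<in>b \<boxplus> c. a \<boxplus> v)"
      using R.hadd_assoc[OF abc(1-3)] by (simp add: image_UN[symmetric])
    also have "\<dots> = (\<Union>v\<in>b \<boxplus> c. \<phi> ` (a \<boxplus> v))"
      by (rule image_UN)
    also have "\<dots> = (\<Union>v\<in>b \<boxplus> c. \<phi> a \<boxplus>\<^bsub>S\<^esub> \<phi> v)"
      using abc R.hadd_closed[of b c] by (intro SUP_cong) (auto simp: sums)
    also have "\<dots> = (\<Union>v\<in>y \<boxplus>\<^bsub>S\<^esub> z. x \<boxplus>\<^bsub>S\<^esub> v)"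
      using abc by (simp add: sums)
    finally show ?case .
  next
    case (4 x y) thus ?case
      using R.hadd_comm by (auto simp: surj sums)
  next
    case 5 show ?case
      using \<phi>(4) R.hzero_closed by (force simp: surj)
  next
    case (6 x)
    then obtain a where "a \<in> carrier R" "x = \<phi> a"
      by (auto simp: surj)
    thus ?case
      using \<phi>(6)[of "\<zero>\<^sub>h" a] \<phi>(4) R.hzero_closed R.hadd_hzero by simp
  next
    case (7 x)
    then obtain a where a: "a \<in> carrier R" "x = \<phi> a"
      by (auto simp: surj)
    have "\<phi> \<zero>\<^sub>h \<in> \<phi> ` (a \<boxplus> \<ominus>\<^sub>h a)"
      using a R.hadd_hopp by blast
    thus ?case
      using a R.hopp_closed by (auto simp: surj \<phi>(6) \<phi>(4))
  next
    case (8 x x' y z)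
    then obtain a a' b where abc: "a \<in> carrier R" "a' \<in> carrier R" "b \<in> carrier R"
      "x = \<phi> a" "x' = \<phi> a'" "y = \<phi> b"
      by (auto simp: surj)
    then obtain c where c: "c \<in> a \<boxplus> b" "z = \<phi> c"
      using 8(5) by (auto simp: sums)
    hence "c \<in> carrier R"
      using abc R.hadd_closed by blast
    moreover have "b \<in> a' \<boxplus> c"
      using R.reversible_opp[OF abc(1-3) _ c(1)] refl abc 8(4) by blast
    ultimately show ?case
      using abc c by (auto simp: sums)
  next
    case 9 show ?case
    proof (rule comm_monoidI)
      show "\<one>\<^bsub>S\<^esub> \<in> carrier S"
        using \<phi>(2)[of \<one>] \<phi>(3) by simp
      show "x \<otimes>\<^bsub>S\<^esub> y = y \<otimes>\<^bsub>S\<^esub> x" if xy: "x \<in> carrier S" "y \<in> carrier S" for x y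
      proof -
        obtain a b where "a \<in> carrier R" "b \<in> carrier R" "x = \<phi> a" "y = \<phi> b"
          using xy by (auto simp: surj)
        thus ?thesis
          using R.m_comm[of a b] by (simp add: \<phi>(5)[symmetric])
      qed
    qed (auto simp: surj \<phi>(5)[symmetric] \<phi>(3)[symmetric] R.m_assoc)
  next
    case (10 x) thus ?case
      using R.hzero_closed R.mult_hzero by (auto simp: surj \<phi>(4)[symmetric] \<phi>(5)[symmetric])
  next
    case (11 x y z)
    then obtain a b c where abc: "a \<in> carrier R" "b \<in> carrier R" "c \<in> carrier R"
      "x = \<phi> a" "y = \<phi> b" "z = \<phi> c"
      by (auto simp: surj)
    have "(\<lambda>u. x \<otimes>\<^bsub>S\<^esub> u) ` (y \<boxplus>\<^bsub>S\<^esub> z) = (\<lambda>u. \<phi> a \<otimes>\<^bsub>S\<^esub> \<phi> u) ` (b \<boxplus> c)"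
      using abc by (simp add: sums image_image)
    also have "\<dots> = (\<lambda>u. \<phi> (a \<otimes> u)) ` (b \<boxplus> c)"
      using abc R.hadd_closed[of b c] by (intro image_cong) (auto simp: \<phi>(5))
    also have "\<dots> = \<phi> ` ((\<lambda>u. a \<otimes> u) ` (b \<boxplus> c))"
      by (simp add: image_image)
    also have "\<dots> = (x \<otimes>\<^bsub>S\<^esub> y) \<boxplus>\<^bsub>S\<^esub> (x \<otimes>\<^bsub>S\<^esub> z)"
      using abc by (simp add: R.distrib \<phi>)
    finally show ?case .
  qed
qed

lemma krasner_hyperdomain_image:
  assumes R: "krasner_hyperdomain R" and emb: "hyperring_embedding \<phi> R S"
    and surj: "carrier S = \<phi> ` carrier R"
  shows "krasner_hyperdomain S"
proof -
  interpret R: krasner_hyperdomain R by fact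
  note \<phi> = hyperring_embeddingD[OF emb]
  have "\<phi> a = \<zero>\<^sub>h\<^bsub>S\<^esub> \<or> \<phi> b = \<zero>\<^sub>h\<^bsub>S\<^esub>"
    if ab: "a \<in> carrier R" "b \<in> carrier R" and eq: "\<phi> a \<otimes>\<^bsub>S\<^esub> \<phi> b = \<zero>\<^sub>h\<^bsub>S\<^esub>" for a b
  proof -
    have "\<phi> (a \<otimes>\<^bsub>R\<^esub> b) = \<phi> \<zero>\<^sub>h\<^bsub>R\<^esub>"
      using ab eq by (simp add: \<phi>)
    hence "a \<otimes>\<^bsub>R\<^esub> b = \<zero>\<^sub>h\<^bsub>R\<^esub>"
      using \<phi>(1) ab R.hzero_closed by (auto dest: inj_onD)
    thus ?thesis
      using R.integral ab \<phi>(4) by metis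
  qed
  thus ?thesis
    using krasner_hyperring_image[OF R.krasner_hyperring_axioms emb surj]
    by (auto simp: krasner_hyperdomain_def krasner_hyperdomain_axioms_def surj)
qed

lemma hyperring_embedding_restrict:
  assumes "hyperring_embedding \<phi> R S" "V \<subseteq> carrier R"
  shows "hyperring_embedding \<phi> (R\<lparr>carrier := V\<rparr>) (S\<lparr>carrier := \<phi> ` V\<rparr>)"
proof -
  have "inj_on \<phi> V"
    using assms inj_on_subset by (auto simp: hyperring_embedding_def)
  moreover have "V \<subseteq> carrier R" "\<And>x. x \<in> V \<Longrightarrow> x \<in> carrier R"
    using assms(2) by auto
  ultimately show ?thesis
    using assms(1) by (simp add: hyperring_embedding_def)
qed

text \<open>
  The opposite of \<open>\<one>\<close> formed inside a subhyperring is the ambient one, and it generates all other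
  opposites by multiplication.
\<close>

lemma (in krasner_hyperring) subhyperring_iff:
  "subhyperring S R \<longleftrightarrow> S \<subseteq> carrier R \<and> \<zero>\<^sub>h \<in> S \<and> \<one> \<in> S \<and> \<ominus>\<^sub>h \<one> \<in> S \<and>
    (\<forall>x\<in>S. \<forall>y\<in>S. x \<otimes> y \<in> S \<and> x \<boxplus> y \<subseteq> S)" (is "?l \<longleftrightarrow> ?r")
proof
  assume ?l
  hence S: "S \<subseteq> carrier R" and "krasner_hyperring (R\<lparr>carrier := S\<rparr>)"
    by (auto simp: subhyperring_def)
  then interpret S: krasner_hyperring "R\<lparr>carrier := S\<rparr>"
    by simp
  have "\<one> \<in> S"
    using S.one_closed by simp
  then obtain y where y: "y \<in> S" "\<zero>\<^sub>h \<in> \<one> \<boxplus> y"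
    using S.hopp_ex1[of \<one>] by auto
  hence "y = \<ominus>\<^sub>h \<one>"
    using S by (intro hopp_unique) auto
  thus ?r
    using S y S.hzero_closed S.one_closed S.m_closed S.hadd_closed by auto
next
  assume r: ?r
  have sub: "x \<in> carrier R" if "x \<in> S" for x
    using that r by blast
  have "krasner_hyperring (R\<lparr>carrier := S\<rparr>)"
  proof (rule krasner_hyperringI, goal_cases)
    case (4 x y)
    thus ?case
      using sub by (simp add: hadd_comm[of x y])
  next
    case (7 x)
    hence "\<ominus>\<^sub>h x \<in> S"
      using hopp_eq_mult[of x] r by auto
    thus ?case
      using hadd_hopp[of x] 7 sub by auto
  next
    case (8 x x' y z)
    thus ?case
      using reversible_opp[of x x' y z] sub by auto
  next
    case 9 show ?case
      by (rule comm_monoidI) (use r in \<open>auto simp: sub m_assoc intro: m_comm\<close>)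
  qed (use r sub in \<open>auto simp: hadd_nonempty hadd_assoc hadd_hzero mult_hzero distrib\<close>)
  thus ?l
    using r by (simp add: subhyperring_def)
qed

section \<open>The quotient hyperfield\<close>

text \<open>
  The axioms of a hyperdomain allow \<open>\<one> = \<zero>\<^sub>h\<close>. In that case no denominators exist and the quotient
  construction has an empty carrier, so this case is excluded here; the existence of a prime
  hyperideal excludes it as well.
\<close>

locale proper_hyperdomain = krasner_hyperdomain +
  assumes one_not_zero: "\<one> \<noteq> \<zero>\<^sub>h"
begin

abbreviation "K \<equiv> quotient_hyperfield R"

lemma one_denom: "\<one> \<in> carrier R - {\<zero>\<^sub>h}"
  using one_not_zero by simp

lemma carrier_K: "carrier K = {hfrac R a b | a b. a \<in> carrier R \<and> b \<in> carrier R - {\<zero>\<^sub>h}}"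
  by (auto simp: quotient_hyperfield_def quotient_def hfrac_def)

lemma carrier_KE:
  assumes "X \<in> carrier K"
  obtains a b where "a \<in> carrier R" "b \<in> carrier R - {\<zero>\<^sub>h}" "X = hfrac R a b"
  using assms by (auto simp: carrier_K)

lemma hfrac_closed: "\<lbrakk>a \<in> carrier R; b \<in> carrier R - {\<zero>\<^sub>h}\<rbrakk> \<Longrightarrow> hfrac R a b \<in> carrier K"
  by (auto simp: carrier_K)

lemma one_K: "\<one>\<^bsub>K\<^esub> = hfrac R \<one> \<one>" and zero_K: "\<zero>\<^sub>h\<^bsub>K\<^esub> = hfrac R \<zero>\<^sub>h \<one>"
  by (simp_all add: quotient_hyperfield_def)

lemma zero_K': "d \<in> carrier R - {\<zero>\<^sub>h} \<Longrightarrow> \<zero>\<^sub>h\<^bsub>K\<^esub> = hfrac R \<zero>\<^sub>h d"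
  using one_denom hzero_closed mult_hzero[of d] mult_hzero[of \<one>] m_comm[of "\<zero>\<^sub>h" d]
  by (simp add: zero_K hfrac_eq_iff)

lemma hfrac_cong:
  assumes "a \<in> carrier R" "b \<in> carrier R - {\<zero>\<^sub>h}" "e \<in> carrier R - {\<zero>\<^sub>h}"
  shows "hfrac R (a \<otimes> e) (b \<otimes> e) = hfrac R a b"
  using assms denom_closed[OF assms(2,3)] by (subst hfrac_eq_iff) (auto simp: m_ac)

lemma hfrac_inj:
  assumes "a \<in> carrier R" "b \<in> carrier R" "d \<in> carrier R - {\<zero>\<^sub>h}" "hfrac R a d = hfrac R b d"
  shows "a = b"
proof -
  have "d \<otimes> a = d \<otimes> b"
    using assms hfrac_eq_iff[OF assms(1,3) assms(2,3)] by (simp add: m_comm)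
  thus ?thesis
    using hyperdomain_cancel assms by blast
qed

lemma hadd_hfrac_common:
  assumes "a \<in> carrier R" "b \<in> carrier R" "d \<in> carrier R - {\<zero>\<^sub>h}"
  shows "hfrac R a d \<boxplus>\<^bsub>K\<^esub> hfrac R b d = (\<lambda>x. hfrac R x d) ` (a \<boxplus> b)"
proof -
  have "(a \<otimes> d) \<boxplus> (d \<otimes> b) = (\<lambda>x. d \<otimes> x) ` (a \<boxplus> b)"
    using assms by (simp add: distrib m_comm)
  hence "hfrac R a d \<boxplus>\<^bsub>K\<^esub> hfrac R b d = (\<lambda>x. hfrac R (d \<otimes> x) (d \<otimes> d)) ` (a \<boxplus> b)"
    using assms by (simp add: hadd_hfrac) blast
  also have "\<dots> = (\<lambda>x. hfrac R x d) ` (a \<boxplus> b)"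
  proof (rule image_cong[OF refl])
    fix x assume "x \<in> a \<boxplus> b"
    hence "x \<in> carrier R"
      using hadd_closed assms by blast
    thus "hfrac R (d \<otimes> x) (d \<otimes> d) = hfrac R x d"
      using hfrac_cong[of x d d] assms by (simp add: m_comm)
  qed
  finally show ?thesis .
qed

text \<open>
  Any three fractions share a denominator \<open>d\<close>, and \<open>x \<mapsto> x / d\<close> is injective and strongly additive
  (\<open>hadd_hfrac_common\<close>). The additive axioms of the quotient hyperfield are therefore inherited from
  \<open>R\<close>.
\<close>

lemma common_denominator:
  assumes "X \<in> carrier K" "Y \<in> carrier K" "Z \<in> carrier K"
  obtains a b c d where "a \<in> carrier R" "b \<in> carrier R" "c \<in> carrier R" "d \<in> carrier R - {\<zero>\<^sub>h}"
    "X = hfrac R a d" "Y = hfrac R b d" "Z = hfrac R c d"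
proof -
  obtain a x where X: "a \<in> carrier R" "x \<in> carrier R - {\<zero>\<^sub>h}" "X = hfrac R a x"
    by (rule carrier_KE[OF assms(1)])
  obtain b y where Y: "b \<in> carrier R" "y \<in> carrier R - {\<zero>\<^sub>h}" "Y = hfrac R b y"
    by (rule carrier_KE[OF assms(2)])
  obtain c z where Z: "c \<in> carrier R" "z \<in> carrier R - {\<zero>\<^sub>h}" "Z = hfrac R c z"
    by (rule carrier_KE[OF assms(3)])
  have D: "y \<otimes> z \<in> carrier R - {\<zero>\<^sub>h}" "x \<otimes> z \<in> carrier R - {\<zero>\<^sub>h}" "x \<otimes> y \<in> carrier R - {\<zero>\<^sub>h}"
    using denom_closed[OF Y(2) Z(2)] denom_closed[OF X(2) Z(2)] denom_closed[OF X(2) Y(2)] .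
  have eq: "y \<otimes> (x \<otimes> z) = x \<otimes> (y \<otimes> z)" "z \<otimes> (x \<otimes> y) = x \<otimes> (y \<otimes> z)"
    using X Y Z by (simp_all add: m_ac)
  show thesis
  proof (rule that)
    show "X = hfrac R (a \<otimes> (y \<otimes> z)) (x \<otimes> (y \<otimes> z))"
      using hfrac_cong[OF X(1,2) D(1)] X(3) by simp
    show "Y = hfrac R (b \<otimes> (x \<otimes> z)) (x \<otimes> (y \<otimes> z))"
      using hfrac_cong[OF Y(1,2) D(2)] Y(3) eq(1) by simp
    show "Z = hfrac R (c \<otimes> (x \<otimes> y)) (x \<otimes> (y \<otimes> z))"
      using hfrac_cong[OF Z(1,2) D(3)] Z(3) eq(2) by simp
    show "x \<otimes> (y \<otimes> z) \<in> carrier R - {\<zero>\<^sub>h}"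
      using denom_closed[OF X(2) D(1)] .
  qed (use X Y Z D in simp_all)
qed

lemma common_denominator2:
  assumes "X \<in> carrier K" "Y \<in> carrier K"
  obtains a b d where "a \<in> carrier R" "b \<in> carrier R" "d \<in> carrier R - {\<zero>\<^sub>h}"
    "X = hfrac R a d" "Y = hfrac R b d"
  by (rule common_denominator[OF assms assms(2)]) (rule that)

lemma krasner_hyperring_quotient: "krasner_hyperring K"
proof (rule krasner_hyperringI, goal_cases)
  case (1 X Y)
  then obtain a b d where "a \<in> carrier R" "b \<in> carrier R" "d \<in> carrier R - {\<zero>\<^sub>h}"
    "X = hfrac R a d" "Y = hfrac R b d"
    by (rule common_denominator2)
  thus ?case
    using hadd_closed[of a b] by (auto simp: hadd_hfrac_common intro!: hfrac_closed)
next
  case (2 X Y)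
  then obtain a b d where "a \<in> carrier R" "b \<in> carrier R" "d \<in> carrier R - {\<zero>\<^sub>h}"
    "X = hfrac R a d" "Y = hfrac R b d"
    by (rule common_denominator2)
  thus ?case
    using hadd_nonempty[of a b] by (auto simp: hadd_hfrac_common)
next
  case (3 X Y Z)
  then obtain a b c d where abc: "a \<in> carrier R" "b \<in> carrier R" "c \<in> carrier R"
    and d: "d \<in> carrier R - {\<zero>\<^sub>h}" and X: "X = hfrac R a d" "Y = hfrac R b d" "Z = hfrac R c d"
    by (rule common_denominator)
  let ?f = "\<lambda>x. hfrac R x d"
  have "(\<Union>u\<in>X \<boxplus>\<^bsub>K\<^esub> Y. u \<boxplus>\<^bsub>K\<^esub> Z) = (\<Union>u\<in>a \<boxplus> b. ?f u \<boxplus>\<^bsub>K\<^esub> ?f c)"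
    using abc d by (simp add: X hadd_hfrac_common)
  also have "\<dots> = (\<Union>u\<in>a \<boxplus> b. ?f ` (u \<boxplus> c))"
    using abc d hadd_closed[of a b] by (intro SUP_cong refl hadd_hfrac_common) auto
  also have "\<dots> = ?f ` (\<Union>v\<in>b \<boxplus> c. a \<boxplus> v)"
    using hadd_assoc[OF abc] by (simp add: image_UN[symmetric])
  also have "\<dots> = (\<Union>v\<in>b \<boxplus> c. ?f ` (a \<boxplus> v))"
    by (rule image_UN)
  also have "\<dots> = (\<Union>v\<in>b \<boxplus> c. ?f a \<boxplus>\<^bsub>K\<^esub> ?f v)"
    using abc d hadd_closed[of b c] by (intro SUP_cong refl hadd_hfrac_common[symmetric]) auto
  also have "\<dots> = (\<Union>v\<in>Y \<boxplus>\<^bsub>K\<^esub> Z. X \<boxplus>\<^bsub>K\<^esub> v)"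
    using abc d by (simp add: X hadd_hfrac_common)
  finally show ?case .
next
  case (4 X Y)
  then obtain a b d where "a \<in> carrier R" "b \<in> carrier R" "d \<in> carrier R - {\<zero>\<^sub>h}"
    "X = hfrac R a d" "Y = hfrac R b d"
    by (rule common_denominator2)
  thus ?case
    using hadd_comm[of a b] by (simp add: hadd_hfrac_common)
next
  case 5 show ?case
    using hfrac_closed[OF hzero_closed one_denom] by (simp add: zero_K)
next
  case (6 X)
  then obtain a d where "a \<in> carrier R" "d \<in> carrier R - {\<zero>\<^sub>h}" "X = hfrac R a d"
    by (elim carrier_KE)
  thus ?case
    using zero_K'[of d] hzero_closed hadd_hzero[of a] by (simp add: hadd_hfrac_common)
next
  case (7 X)
  then obtain a d where ad: "a \<in> carrier R" "d \<in> carrier R - {\<zero>\<^sub>h}" "X = hfrac R a d"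
    by (elim carrier_KE)
  hence "\<zero>\<^sub>h\<^bsub>K\<^esub> \<in> X \<boxplus>\<^bsub>K\<^esub> hfrac R (\<ominus>\<^sub>h a) d"
    using zero_K'[of d] hadd_hopp[of a] hopp_closed[of a] by (simp add: hadd_hfrac_common)
  thus ?case
    using hfrac_closed hopp_closed ad by blast
next
  case (8 X X' Y Z)
  obtain a a' b d where abc: "a \<in> carrier R" "a' \<in> carrier R" "b \<in> carrier R"
    and d: "d \<in> carrier R - {\<zero>\<^sub>h}" and X: "X = hfrac R a d" "X' = hfrac R a' d" "Y = hfrac R b d"
    by (rule common_denominator[OF 8(1-3)])
  obtain e where e: "e \<in> a \<boxplus> a'" "hfrac R \<zero>\<^sub>h d = hfrac R e d"
    using 8(4) zero_K'[OF d] abc d by (auto simp: X hadd_hfrac_common)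
  have "e = \<zero>\<^sub>h"
    using e hadd_closed[OF abc(1,2)] hzero_closed d by (intro hfrac_inj[of e "\<zero>\<^sub>h" d]) auto
  moreover obtain c where c: "c \<in> a \<boxplus> b" "Z = hfrac R c d"
    using 8(5) abc d by (auto simp: X hadd_hfrac_common)
  moreover have "c \<in> carrier R"
    using c hadd_closed[OF abc(1,3)] by blast
  ultimately show ?case
    using reversible_opp[OF abc, of c] e(1) abc d by (simp add: X hadd_hfrac_common)
next
  case 9
  show ?case
  proof (rule comm_monoidI)
    fix X Y assume "X \<in> carrier K" "Y \<in> carrier K"
    then obtain a b c d where fr: "a \<in> carrier R" "b \<in> carrier R - {\<zero>\<^sub>h}" "c \<in> carrier R"
      "d \<in> carrier R - {\<zero>\<^sub>h}" "X = hfrac R a b" "Y = hfrac R c d"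
      by (elim carrier_KE)
    show "X \<otimes>\<^bsub>K\<^esub> Y \<in> carrier K"
      using fr denom_closed[of b d] hfrac_closed[of "a \<otimes> c" "b \<otimes> d"] by (simp add: mult_hfrac)
    show "X \<otimes>\<^bsub>K\<^esub> Y = Y \<otimes>\<^bsub>K\<^esub> X"
      using fr m_comm[of a c] m_comm[of b d] by (simp add: mult_hfrac)
    fix Z assume "Z \<in> carrier K"
    then obtain e f where fr': "e \<in> carrier R" "f \<in> carrier R - {\<zero>\<^sub>h}" "Z = hfrac R e f"
      by (elim carrier_KE)
    show "X \<otimes>\<^bsub>K\<^esub> Y \<otimes>\<^bsub>K\<^esub> Z = X \<otimes>\<^bsub>K\<^esub> (Y \<otimes>\<^bsub>K\<^esub> Z)"
      using fr fr' denom_closed[of b d] denom_closed[of d f] by (simp add: mult_hfrac m_assoc)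
  next
    show "\<one>\<^bsub>K\<^esub> \<in> carrier K"
      using hfrac_closed[OF one_closed one_denom] by (simp add: one_K)
  next
    fix X assume "X \<in> carrier K"
    then obtain a b where "a \<in> carrier R" "b \<in> carrier R - {\<zero>\<^sub>h}" "X = hfrac R a b"
      by (elim carrier_KE)
    thus "\<one>\<^bsub>K\<^esub> \<otimes>\<^bsub>K\<^esub> X = X"
      using one_denom by (simp add: one_K mult_hfrac)
  qed
next
  case (10 X)
  then obtain a d where ad: "a \<in> carrier R" "d \<in> carrier R - {\<zero>\<^sub>h}" "X = hfrac R a d"
    by (elim carrier_KE)
  have "X \<otimes>\<^bsub>K\<^esub> \<zero>\<^sub>h\<^bsub>K\<^esub> = hfrac R \<zero>\<^sub>h (d \<otimes> \<one>)"
    using ad one_denom hzero_closed mult_hzero[of a] by (subst zero_K, subst ad(3), subst mult_hfrac) auto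
  thus ?case
    using zero_K'[of d] ad by simp
next
  case (11 X Y Z)
  then obtain a b c d where abc: "a \<in> carrier R" "b \<in> carrier R" "c \<in> carrier R"
    and d: "d \<in> carrier R - {\<zero>\<^sub>h}" and X: "X = hfrac R a d" "Y = hfrac R b d" "Z = hfrac R c d"
    by (rule common_denominator)
  have dd: "d \<otimes> d \<in> carrier R - {\<zero>\<^sub>h}"
    using denom_closed d by blast
  have "(\<lambda>u. X \<otimes>\<^bsub>K\<^esub> u) ` (Y \<boxplus>\<^bsub>K\<^esub> Z) = (\<lambda>x. X \<otimes>\<^bsub>K\<^esub> hfrac R x d) ` (b \<boxplus> c)"
    using abc d by (simp add: X hadd_hfrac_common image_image)
  also have "\<dots> = (\<lambda>x. hfrac R (a \<otimes> x) (d \<otimes> d)) ` (b \<boxplus> c)"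
    using abc d hadd_closed[of b c] unfolding X by (intro image_cong refl mult_hfrac) auto
  also have "\<dots> = (\<lambda>x. hfrac R x (d \<otimes> d)) ` ((a \<otimes> b) \<boxplus> (a \<otimes> c))"
    using abc by (simp add: distrib[symmetric] image_image)
  also have "\<dots> = (X \<otimes>\<^bsub>K\<^esub> Y) \<boxplus>\<^bsub>K\<^esub> (X \<otimes>\<^bsub>K\<^esub> Z)"
    using abc d dd by (simp add: X mult_hfrac hadd_hfrac_common)
  finally show ?case .
qed

lemma hfrac_eq_zero_iff:
  assumes "a \<in> carrier R" "b \<in> carrier R - {\<zero>\<^sub>h}"
  shows "hfrac R a b = \<zero>\<^sub>h\<^bsub>K\<^esub> \<longleftrightarrow> a = \<zero>\<^sub>h"
  using assms one_denom hzero_closed mult_hzero[of b] by (simp add: zero_K hfrac_eq_iff)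

lemma quotient_inverse:
  assumes "X \<in> carrier K" "X \<noteq> \<zero>\<^sub>h\<^bsub>K\<^esub>"
  shows "\<exists>Y\<in>carrier K. X \<otimes>\<^bsub>K\<^esub> Y = \<one>\<^bsub>K\<^esub>"
proof -
  obtain a b where ab: "a \<in> carrier R" "b \<in> carrier R - {\<zero>\<^sub>h}" "X = hfrac R a b"
    using assms(1) by (elim carrier_KE)
  hence a: "a \<in> carrier R - {\<zero>\<^sub>h}"
    using assms(2) hfrac_eq_zero_iff by blast
  have "X \<otimes>\<^bsub>K\<^esub> hfrac R b a = hfrac R (a \<otimes> b) (b \<otimes> a)"
    using ab a by (simp add: mult_hfrac)
  also have "\<dots> = \<one>\<^bsub>K\<^esub>"
    using ab a one_denom denom_closed[of b a] by (simp add: one_K hfrac_eq_iff m_comm)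
  finally show ?thesis
    using ab a hfrac_closed[of b a] by auto
qed

lemma krasner_hyperdomain_quotient: "krasner_hyperdomain K"
proof -
  interpret K: krasner_hyperring K
    by (rule krasner_hyperring_quotient)
  have "X = \<zero>\<^sub>h\<^bsub>K\<^esub> \<or> Y = \<zero>\<^sub>h\<^bsub>K\<^esub>"
    if XY: "X \<in> carrier K" "Y \<in> carrier K" "X \<otimes>\<^bsub>K\<^esub> Y = \<zero>\<^sub>h\<^bsub>K\<^esub>" for X Y
  proof (rule disjCI)
    assume "Y \<noteq> \<zero>\<^sub>h\<^bsub>K\<^esub>"
    then obtain Z where Z: "Z \<in> carrier K" "Y \<otimes>\<^bsub>K\<^esub> Z = \<one>\<^bsub>K\<^esub>"
      using quotient_inverse XY by blast
    hence "X = (X \<otimes>\<^bsub>K\<^esub> Y) \<otimes>\<^bsub>K\<^esub> Z"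
      using XY(1,2) K.m_assoc[of X Y Z] by simp
    thus "X = \<zero>\<^sub>h\<^bsub>K\<^esub>"
      using XY Z K.mult_hzero[of Z] K.hzero_closed by (simp add: K.m_comm)
  qed
  thus ?thesis
    by (simp add: krasner_hyperdomain_def krasner_hyperdomain_axioms_def K.krasner_hyperring_axioms)
qed

lemma frac_embed_embedding: "hyperring_embedding (frac_embed R) R K"
proof -
  have "frac_embed R ` (x \<boxplus> y) = frac_embed R x \<boxplus>\<^bsub>K\<^esub> frac_embed R y"
    if "x \<in> carrier R" "y \<in> carrier R" for x y
    using hadd_hfrac_common[OF that one_denom] by (simp add: frac_embed_def)
  moreover have "inj_on (frac_embed R) (carrier R)"
    using hfrac_inj[OF _ _ one_denom] by (auto simp: inj_on_def frac_embed_def)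
  moreover have "frac_embed R ` carrier R \<subseteq> carrier K"
    using hfrac_closed[OF _ one_denom] by (auto simp: frac_embed_def)
  ultimately show ?thesis
    using one_denom by (simp add: hyperring_embedding_def frac_embed_def one_K zero_K mult_hfrac)
qed

lemma hfrac_mult_denominator:
  assumes "a \<in> carrier R" "b \<in> carrier R - {\<zero>\<^sub>h}"
  shows "hfrac R a b \<otimes>\<^bsub>K\<^esub> frac_embed R b = frac_embed R a"
proof -
  have "hfrac R a b \<otimes>\<^bsub>K\<^esub> frac_embed R b = hfrac R (\<one> \<otimes> a \<otimes> b) (\<one> \<otimes> b)"
    using assms one_denom by (simp add: frac_embed_def mult_hfrac)
  thus ?thesis
    using hfrac_cong[of "\<one> \<otimes> a" \<one> b] assms one_denom by (simp add: frac_embed_def)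
qed

text \<open>
  The valuation condition without the operation \<open>inv\<close>; this form is invariant under isomorphisms.
\<close>

lemma hypervaluation_hyperring_iff:
  "hypervaluation_hyperring V K \<longleftrightarrow> subhyperring V K \<and>
    (\<forall>a\<in>carrier K. \<forall>b\<in>carrier K. a \<otimes>\<^bsub>K\<^esub> b = \<one>\<^bsub>K\<^esub> \<longrightarrow> a \<in> V \<or> b \<in> V)"
proof -
  interpret K: krasner_hyperdomain K
    by (rule krasner_hyperdomain_quotient)
  have ne: "\<one>\<^bsub>K\<^esub> \<noteq> \<zero>\<^sub>h\<^bsub>K\<^esub>"
    using hfrac_eq_zero_iff[OF one_closed one_denom] one_not_zero by (simp add: one_K)
  have nz: "a \<noteq> \<zero>\<^sub>h\<^bsub>K\<^esub> \<and> inv\<^bsub>K\<^esub> a = b"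
    if "a \<in> carrier K" "b \<in> carrier K" "a \<otimes>\<^bsub>K\<^esub> b = \<one>\<^bsub>K\<^esub>" for a b
    using that ne K.inv_unique'[of a b] K.mult_hzero[of b] K.m_comm[of a b] by auto
  have "(\<forall>a\<in>carrier K. a \<noteq> \<zero>\<^sub>h\<^bsub>K\<^esub> \<longrightarrow> a \<in> V \<or> inv\<^bsub>K\<^esub> a \<in> V) \<longleftrightarrow>
    (\<forall>a\<in>carrier K. \<forall>b\<in>carrier K. a \<otimes>\<^bsub>K\<^esub> b = \<one>\<^bsub>K\<^esub> \<longrightarrow> a \<in> V \<or> b \<in> V)"
    using nz quotient_inverse by metis
  thus ?thesis
    by (simp add: hypervaluation_hyperring_def)
qed

end

lemma (in krasner_hyperdomain) proper_hyperdomain_if_prime: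
  "prime_hyperideal P R \<Longrightarrow> proper_hyperdomain R"
  using prime_hyperidealD(3,4)[of P] by unfold_locales auto

section \<open>Transport of hypervaluation hyperrings\<close>

lemma hyperideal_image:
  assumes R: "krasner_hyperring R" and S: "krasner_hyperring S"
    and emb: "hyperring_embedding \<phi> R S" and surj: "carrier S = \<phi> ` carrier R"
    and J: "hyperideal J R"
  shows "hyperideal (\<phi> ` J) S"
proof -
  interpret R: krasner_hyperring R by fact
  interpret S: krasner_hyperring S by fact
  note \<phi> = hyperring_embeddingD[OF emb] and J' = R.hyperidealD[OF J]
  have "\<phi> a \<boxplus>\<^bsub>S\<^esub> \<phi> b \<subseteq> \<phi> ` J" if "a \<in> J" "b \<in> J" for a b
    using that J'(1) J'(2)[OF that] \<phi>(6)[of a b] by blast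
  moreover have "\<phi> a \<otimes>\<^bsub>S\<^esub> \<phi> r \<in> \<phi> ` J" if "a \<in> J" "r \<in> carrier R" for a r
    using that J'(1) J'(3)[OF that] \<phi>(5)[of a r] by force
  moreover have "\<phi> ` J \<subseteq> carrier S" "\<phi> ` J \<noteq> {}"
    using J' surj by auto
  ultimately show ?thesis
    unfolding S.hyperideal_iff surj by blast
qed

lemma hyperring_embedding_inv_into:
  assumes R: "krasner_hyperring R"
    and emb: "hyperring_embedding \<phi> R S" and surj: "carrier S = \<phi> ` carrier R"
  shows "hyperring_embedding (inv_into (carrier R) \<phi>) S R"
proof -
  interpret R: krasner_hyperring R by fact
  note \<phi> = hyperring_embeddingD[OF emb]
  let ?g = "inv_into (carrier R) \<phi>"
  have g: "?g (\<phi> x) = x" if "x \<in> carrier R" for x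
    using \<phi>(1) that by simp
  have "?g ` (\<phi> x \<boxplus>\<^bsub>S\<^esub> \<phi> y) = x \<boxplus>\<^bsub>R\<^esub> y" if "x \<in> carrier R" "y \<in> carrier R" for x y
    using R.hadd_closed[OF that] \<phi>(1) that by (simp add: \<phi>(6)[symmetric] inv_into_image_cancel)
  moreover have "?g (\<phi> x \<otimes>\<^bsub>S\<^esub> \<phi> y) = x \<otimes>\<^bsub>R\<^esub> y" if "x \<in> carrier R" "y \<in> carrier R" for x y
    using g[of "x \<otimes>\<^bsub>R\<^esub> y"] that by (simp add: \<phi>(5))
  moreover have "inj_on ?g (carrier S)"
    unfolding surj by (rule inj_on_inv_into) simp
  ultimately show ?thesis
    using g g[OF R.one_closed] g[OF R.hzero_closed]
    by (simp add: hyperring_embedding_def surj \<phi>(3,4) image_image)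
qed

lemma hypervaluation_hyperring_image:
  assumes R: "proper_hyperdomain R" and S: "proper_hyperdomain S"
    and emb: "hyperring_embedding \<Phi> (quotient_hyperfield R) (quotient_hyperfield S)"
    and surj: "carrier (quotient_hyperfield S) = \<Phi> ` carrier (quotient_hyperfield R)"
    and V: "hypervaluation_hyperring V (quotient_hyperfield R)"
  shows "hypervaluation_hyperring (\<Phi> ` V) (quotient_hyperfield S)"
proof -
  interpret R: proper_hyperdomain R by fact
  interpret S: proper_hyperdomain S by fact
  note \<Phi> = hyperring_embeddingD[OF emb]
  interpret K: krasner_hyperring R.K
    by (rule R.krasner_hyperring_quotient)
  have V': "V \<subseteq> carrier R.K" "krasner_hyperring (R.K\<lparr>carrier := V\<rparr>)"
    "\<And>a b. \<lbrakk>a \<in> carrier R.K; b \<in> carrier R.K; a \<otimes>\<^bsub>R.K\<^esub> b = \<one>\<^bsub>R.K\<^esub>\<rbrakk> \<Longrightarrow> a \<in> V \<or> b \<in> V"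
    using V by (auto simp: R.hypervaluation_hyperring_iff subhyperring_def)
  have "subhyperring (\<Phi> ` V) S.K"
    using krasner_hyperring_image[OF V'(2) hyperring_embedding_restrict[OF emb V'(1)]] V'(1) surj
    by (auto simp: subhyperring_def)
  moreover have "\<Phi> a \<in> \<Phi> ` V \<or> \<Phi> b \<in> \<Phi> ` V"
    if ab: "a \<in> carrier R.K" "b \<in> carrier R.K" "\<Phi> a \<otimes>\<^bsub>S.K\<^esub> \<Phi> b = \<one>\<^bsub>S.K\<^esub>" for a b
  proof -
    have "\<Phi> (a \<otimes>\<^bsub>R.K\<^esub> b) = \<Phi> \<one>\<^bsub>R.K\<^esub>"
      using ab by (simp add: \<Phi>)
    hence "a \<otimes>\<^bsub>R.K\<^esub> b = \<one>\<^bsub>R.K\<^esub>"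
      using \<Phi>(1) ab by (auto dest: inj_onD)
    thus ?thesis
      using V'(3) ab by blast
  qed
  ultimately show ?thesis
    unfolding S.hypervaluation_hyperring_iff surj by blast
qed

text \<open>
  For a map \<open>\<psi>\<close> from \<open>R\<close> to a hyperfield \<open>K\<close>: the subset \<open>I\<close> of \<open>R\<close> is the preimage of a hyperideal of
  some hypervaluation hyperring of \<open>K\<close> that contains the image of \<open>R\<close>. With the map \<open>\<psi>\<close> as a parameter,
  \<open>R\<close> can be placed in the quotient hyperfield of another hyperdomain.
\<close>

definition valuation_contraction ::
    "('a \<Rightarrow> 'b) \<Rightarrow> ('a, 'm) hyperring_scheme \<Rightarrow> ('b, 'n) hyperring_scheme \<Rightarrow> 'a set \<Rightarrow> bool"
  where "valuation_contraction \<psi> R K I \<longleftrightarrow>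
    (\<exists>V J. hypervaluation_hyperring V K \<and> \<psi> ` carrier R \<subseteq> V \<and>
      hyperideal J (K\<lparr>carrier := V\<rparr>) \<and> \<psi> ` I = J \<inter> \<psi> ` carrier R)"

lemma hypervaluation_hyperideal_iff:
  "hypervaluation_hyperideal I R \<longleftrightarrow>
    hyperideal I R \<and> valuation_contraction (frac_embed R) R (quotient_hyperfield R) I"
  by (simp add: hypervaluation_hyperideal_def valuation_contraction_def)

lemma valuation_contraction_transport:
  assumes R: "proper_hyperdomain R" and S: "proper_hyperdomain S"
    and emb: "hyperring_embedding \<Phi> (quotient_hyperfield R) (quotient_hyperfield S)"
    and surj: "carrier (quotient_hyperfield S) = \<Phi> ` carrier (quotient_hyperfield R)"
    and \<psi>: "\<And>x. x \<in> carrier T \<Longrightarrow> \<psi> x \<in> carrier (quotient_hyperfield R) \<and> \<Phi> (\<psi> x) = \<psi>' x"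
    and I: "I \<subseteq> carrier T"
    and val: "valuation_contraction \<psi> T (quotient_hyperfield R) I"
  shows "valuation_contraction \<psi>' T (quotient_hyperfield S) I"
proof -
  let ?K = "quotient_hyperfield R" and ?L = "quotient_hyperfield S"
  obtain V J where V: "hypervaluation_hyperring V ?K" "\<psi> ` carrier T \<subseteq> V"
    and J: "hyperideal J (?K\<lparr>carrier := V\<rparr>)" and IJ: "\<psi> ` I = J \<inter> \<psi> ` carrier T"
    using val unfolding valuation_contraction_def by (elim exE conjE) (rule that)
  have V': "V \<subseteq> carrier ?K" "krasner_hyperring (?K\<lparr>carrier := V\<rparr>)"
    using V(1) by (simp_all add: hypervaluation_hyperring_def subhyperring_def)
  have JV: "J \<subseteq> V"
    using J by (simp add: hyperideal_def)
  have W: "hypervaluation_hyperring (\<Phi> ` V) ?L"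
    by (rule hypervaluation_hyperring_image[OF R S emb surj V(1)])
  hence "krasner_hyperring (?L\<lparr>carrier := \<Phi> ` V\<rparr>)"
    by (simp add: hypervaluation_hyperring_def subhyperring_def)
  hence "hyperideal (\<Phi> ` J) (?L\<lparr>carrier := \<Phi> ` V\<rparr>)"
    using hyperideal_image[OF V'(2) _ hyperring_embedding_restrict[OF emb V'(1)] _ J] by simp
  moreover have comp: "\<psi>' ` A = \<Phi> ` \<psi> ` A" if "A \<subseteq> carrier T" for A
    unfolding image_image using \<psi> that by (intro image_cong) auto
  moreover have "\<Phi> ` (J \<inter> \<psi> ` carrier T) = \<Phi> ` J \<inter> \<Phi> ` \<psi> ` carrier T"
    using V(2) V'(1) JV by (intro inj_on_image_Int[OF hyperring_embeddingD(1)[OF emb]]) auto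
  hence "\<psi>' ` I = \<Phi> ` J \<inter> \<psi>' ` carrier T"
    unfolding comp[OF I] comp[OF subset_refl] IJ .
  moreover have "\<psi>' ` carrier T \<subseteq> \<Phi> ` V"
    unfolding comp[OF subset_refl] using V(2) by (rule image_mono)
  ultimately show ?thesis
    unfolding valuation_contraction_def using W by (intro exI conjI)
qed

section \<open>Localization at a prime hyperideal\<close>

text \<open>
  \<open>S\<close> is a localization of \<open>R\<close> at the prime hyperideal \<open>P\<close>, described by its properties: \<open>\<phi>\<close> embeds \<open>R\<close>
  in \<open>S\<close>, elements outside \<open>P\<close> become units, and every element of \<open>S\<close> has the form \<open>\<phi> a / \<phi> s\<close> with
  \<open>s \<notin> P\<close>. No model is fixed, so that the carrier of \<open>S\<close> may live in any type.
\<close>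

locale hyper_localization = R: proper_hyperdomain R + S: proper_hyperdomain S
  for R :: "('a, 'm) hyperring_scheme" (structure) and S :: "('b, 'n) hyperring_scheme" +
  fixes \<phi> :: "'a \<Rightarrow> 'b" and P :: "'a set"
  assumes prime: "prime_hyperideal P R"
    and embedding: "hyperring_embedding \<phi> R S"
    and unit: "s \<in> carrier R - P \<Longrightarrow> \<exists>u\<in>carrier S. \<phi> s \<otimes>\<^bsub>S\<^esub> u = \<one>\<^bsub>S\<^esub>"
    and fraction: "z \<in> carrier S \<Longrightarrow> \<exists>a\<in>carrier R. \<exists>s\<in>carrier R - P. z \<otimes>\<^bsub>S\<^esub> \<phi> s = \<phi> a"
begin

lemmas phi = hyperring_embeddingD[OF embedding]
lemmas primeD = R.prime_hyperidealD[OF prime]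

lemma phi_eq_iff: "\<lbrakk>x \<in> carrier R; y \<in> carrier R\<rbrakk> \<Longrightarrow> \<phi> x = \<phi> y \<longleftrightarrow> x = y"
  using phi(1) by (auto dest: inj_onD)

lemma fractionE:
  assumes "z \<in> carrier S"
  obtains a s where "a \<in> carrier R" "s \<in> carrier R" "s \<notin> P" "z \<otimes>\<^bsub>S\<^esub> \<phi> s = \<phi> a"
  using fraction[OF assms] by blast

lemma denominator_mult: "\<lbrakk>s \<in> carrier R; t \<in> carrier R; s \<notin> P; t \<notin> P\<rbrakk> \<Longrightarrow> s \<otimes> t \<notin> P"
  using primeD(5) by blast

lemma fraction_mult:
  assumes "z \<in> carrier S" "w \<in> carrier S" "a \<in> carrier R" "b \<in> carrier R"
    "s \<in> carrier R" "t \<in> carrier R" "z \<otimes>\<^bsub>S\<^esub> \<phi> s = \<phi> a" "w \<otimes>\<^bsub>S\<^esub> \<phi> t = \<phi> b"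
  shows "(z \<otimes>\<^bsub>S\<^esub> w) \<otimes>\<^bsub>S\<^esub> \<phi> (s \<otimes> t) = \<phi> (a \<otimes> b)"
proof -
  have "(z \<otimes>\<^bsub>S\<^esub> w) \<otimes>\<^bsub>S\<^esub> \<phi> (s \<otimes> t) = (z \<otimes>\<^bsub>S\<^esub> \<phi> s) \<otimes>\<^bsub>S\<^esub> (w \<otimes>\<^bsub>S\<^esub> \<phi> t)"
    using assms(1-6) phi(2) by (simp add: phi(5) S.m_ac)
  thus ?thesis
    using assms by (simp add: phi(5))
qed

text \<open>
  The contraction of a hyperideal of \<open>S\<close> to \<open>R\<close>.
\<close>

definition contr :: "'b set \<Rightarrow> 'a set"
  where "contr J = {a \<in> carrier R. \<phi> a \<in> J}"

text \<open>
  The extension of a hyperideal \<open>I\<close> of \<open>R\<close> to \<open>S\<close>: the fractions with numerator in \<open>I\<close> and denominator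
  outside \<open>P\<close>.
\<close>

definition ext :: "'a set \<Rightarrow> 'b set"
  where "ext I = {z \<in> carrier S. \<exists>a\<in>I. \<exists>s\<in>carrier R - P. z \<otimes>\<^bsub>S\<^esub> \<phi> s = \<phi> a}"

lemma hyperideal_contr:
  assumes "hyperideal J S"
  shows "hyperideal (contr J) R"
proof -
  note J = S.hyperidealD[OF assms]
  have "\<zero>\<^sub>h \<in> contr J"
    using J(4) phi(4) R.hzero_closed by (simp add: contr_def)
  moreover have "a \<boxplus> b \<subseteq> contr J" if "a \<in> contr J" "b \<in> contr J" for a b
    using that J(2)[of "\<phi> a" "\<phi> b"] R.hadd_closed[of a b] phi(6)[of a b]
    by (auto simp: contr_def)
  moreover have "a \<otimes> r \<in> contr J" if "a \<in> contr J" "r \<in> carrier R" for a r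
    using that J(3) phi(2) by (auto simp: contr_def phi(5))
  moreover have "contr J \<subseteq> carrier R"
    by (auto simp: contr_def)
  ultimately show ?thesis
    unfolding R.hyperideal_iff by blast
qed

text \<open>
  A fraction and its numerator differ by a unit of \<open>S\<close>, so a hyperideal of \<open>S\<close> is determined by its
  contraction. All comparisons between \<open>R\<close> and \<open>S\<close> below reduce to this.
\<close>

lemma mem_iff_contr:
  assumes "hyperideal J S" "z \<in> carrier S" "a \<in> carrier R" "s \<in> carrier R" "s \<notin> P"
    "z \<otimes>\<^bsub>S\<^esub> \<phi> s = \<phi> a"
  shows "z \<in> J \<longleftrightarrow> a \<in> contr J"
proof -
  obtain u where "u \<in> carrier S" "\<phi> s \<otimes>\<^bsub>S\<^esub> u = \<one>\<^bsub>S\<^esub>"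
    using unit[of s] assms by auto
  thus ?thesis
    using S.hyperideal_mult_unit_iff[of J z "\<phi> s" u] assms phi(2) by (simp add: contr_def)
qed

lemma hyperideal_ext:
  assumes "hyperideal I R"
  shows "hyperideal (ext I) S"
proof -
  note I = R.hyperidealD[OF assms]
  have "\<zero>\<^sub>h\<^bsub>S\<^esub> \<in> ext I"
  proof -
    have "\<zero>\<^sub>h\<^bsub>S\<^esub> \<otimes>\<^bsub>S\<^esub> \<phi> \<one> = \<phi> \<zero>\<^sub>h" "\<one> \<in> carrier R - P"
      using S.hzero_closed primeD(4) by (simp_all add: phi(3,4))
    thus ?thesis
      using I(4) S.hzero_closed unfolding ext_def by blast
  qed
  moreover have "z \<boxplus>\<^bsub>S\<^esub> w \<subseteq> ext I" if zw: "z \<in> ext I" "w \<in> ext I" for z w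
  proof
    fix x assume x: "x \<in> z \<boxplus>\<^bsub>S\<^esub> w"
    obtain a s where a: "a \<in> I" "s \<in> carrier R" "s \<notin> P" "z \<otimes>\<^bsub>S\<^esub> \<phi> s = \<phi> a"
      using zw(1) by (auto simp: ext_def)
    obtain b t where b: "b \<in> I" "t \<in> carrier R" "t \<notin> P" "w \<otimes>\<^bsub>S\<^esub> \<phi> t = \<phi> b"
      using zw(2) by (auto simp: ext_def)
    have c: "z \<in> carrier S" "w \<in> carrier S" "a \<in> carrier R" "b \<in> carrier R"
      using zw a b I(1) by (auto simp: ext_def)
    have x': "x \<in> carrier S"
      using x S.hadd_closed[OF c(1,2)] by blast
    have "\<phi> (s \<otimes> t) \<otimes>\<^bsub>S\<^esub> z = (z \<otimes>\<^bsub>S\<^esub> \<phi> s) \<otimes>\<^bsub>S\<^esub> \<phi> t"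
      using c a(2) b(2) phi(2) by (simp add: phi(5) S.m_ac)
    hence z: "\<phi> (s \<otimes> t) \<otimes>\<^bsub>S\<^esub> z = \<phi> (a \<otimes> t)"
      using c a b by (simp add: phi(5))
    have "\<phi> (s \<otimes> t) \<otimes>\<^bsub>S\<^esub> w = (w \<otimes>\<^bsub>S\<^esub> \<phi> t) \<otimes>\<^bsub>S\<^esub> \<phi> s"
      using c a(2) b(2) phi(2) by (simp add: phi(5) S.m_ac)
    hence w: "\<phi> (s \<otimes> t) \<otimes>\<^bsub>S\<^esub> w = \<phi> (b \<otimes> s)"
      using c a b by (simp add: phi(5))
    have "\<phi> (s \<otimes> t) \<otimes>\<^bsub>S\<^esub> x \<in> (\<lambda>u. \<phi> (s \<otimes> t) \<otimes>\<^bsub>S\<^esub> u) ` (z \<boxplus>\<^bsub>S\<^esub> w)"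
      using x by blast
    also have "\<dots> = \<phi> ` (a \<otimes> t \<boxplus> b \<otimes> s)"
      using c a(2) b(2) phi(2) z w by (simp add: S.distrib phi(6))
    finally obtain d where d: "d \<in> a \<otimes> t \<boxplus> b \<otimes> s" "\<phi> (s \<otimes> t) \<otimes>\<^bsub>S\<^esub> x = \<phi> d"
      by blast
    have "d \<in> I"
      using d(1) I(2)[OF I(3)[OF a(1) b(2)] I(3)[OF b(1) a(2)]] by blast
    moreover have "x \<otimes>\<^bsub>S\<^esub> \<phi> (s \<otimes> t) = \<phi> d"
      using d(2) x' phi(2)[of "s \<otimes> t"] a(2) b(2) S.m_comm by simp
    moreover have "s \<otimes> t \<in> carrier R - P"
      using denominator_mult a b by simp
    ultimately show "x \<in> ext I"
      using x' by (auto simp: ext_def)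
  qed
  moreover have "z \<otimes>\<^bsub>S\<^esub> r \<in> ext I" if z: "z \<in> ext I" "r \<in> carrier S" for z r
  proof -
    obtain a s where a: "a \<in> I" "s \<in> carrier R" "s \<notin> P" "z \<otimes>\<^bsub>S\<^esub> \<phi> s = \<phi> a"
      using z(1) by (auto simp: ext_def)
    obtain b t where b: "b \<in> carrier R" "t \<in> carrier R" "t \<notin> P" "r \<otimes>\<^bsub>S\<^esub> \<phi> t = \<phi> b"
      using fractionE[OF z(2)] .
    have c: "z \<in> carrier S" "a \<in> carrier R"
      using z a I(1) by (auto simp: ext_def)
    have "(z \<otimes>\<^bsub>S\<^esub> r) \<otimes>\<^bsub>S\<^esub> \<phi> (s \<otimes> t) = \<phi> (a \<otimes> b)"
      using fraction_mult[OF c(1) z(2) c(2) b(1) a(2) b(2) a(4) b(4)] .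
    moreover have "a \<otimes> b \<in> I" "s \<otimes> t \<in> carrier R - P" "z \<otimes>\<^bsub>S\<^esub> r \<in> carrier S"
      using I(3) denominator_mult a b c z by auto
    ultimately show ?thesis
      unfolding ext_def by blast
  qed
  moreover have "ext I \<subseteq> carrier S"
    by (auto simp: ext_def)
  ultimately show ?thesis
    unfolding S.hyperideal_iff by blast
qed

text \<open>
  If \<open>a \<otimes> s \<in> Q\<close> with \<open>s \<notin> P = \<surd>Q\<close> then \<open>a \<in> Q\<close>, because \<open>Q\<close> is primary; hence no element is gained
  by extending and contracting.
\<close>

lemma contr_ext_primary:
  assumes "Q \<in> primary_hyperideals_of R P"
  shows "contr (ext Q) = Q"
proof
  have Q: "primary_hyperideal Q R" "hyperradical R Q = P" "Q \<subseteq> carrier R"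
    using assms by (auto simp: primary_hyperideals_of_def primary_hyperideal_def hyperideal_def)
  show "contr (ext Q) \<subseteq> Q"
  proof
    fix a assume "a \<in> contr (ext Q)"
    then obtain b s where b: "a \<in> carrier R" "b \<in> Q" "s \<in> carrier R" "s \<notin> P"
      "\<phi> a \<otimes>\<^bsub>S\<^esub> \<phi> s = \<phi> b"
      by (auto simp: contr_def ext_def)
    hence "a \<otimes> s = b"
      using phi_eq_iff[of "a \<otimes> s" b] Q(3) by (auto simp: phi(5))
    thus "a \<in> Q"
      using Q(1,2) b by (auto simp: primary_hyperideal_def)
  qed
  show "Q \<subseteq> contr (ext Q)"
  proof
    fix a assume a: "a \<in> Q"
    hence "\<phi> a \<otimes>\<^bsub>S\<^esub> \<phi> \<one> = \<phi> a" "a \<in> carrier R" "\<phi> a \<in> carrier S"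
      using Q(3) phi(2) by (auto simp: phi(3))
    thus "a \<in> contr (ext Q)"
      using a primeD(4) R.one_closed unfolding contr_def ext_def by blast
  qed
qed

lemma contr_mono_iff:
  assumes "hyperideal I S" "hyperideal J S"
  shows "contr I \<subseteq> contr J \<longleftrightarrow> I \<subseteq> J"
proof
  assume sub: "contr I \<subseteq> contr J"
  show "I \<subseteq> J"
  proof
    fix z assume z: "z \<in> I"
    hence zc: "z \<in> carrier S"
      using S.hyperidealD(1)[OF assms(1)] by blast
    then obtain a s where a: "a \<in> carrier R" "s \<in> carrier R" "s \<notin> P" "z \<otimes>\<^bsub>S\<^esub> \<phi> s = \<phi> a"
      by (rule fractionE)
    show "z \<in> J"
      using mem_iff_contr[OF assms(1) zc a] mem_iff_contr[OF assms(2) zc a] z sub by blast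
  qed
qed (auto simp: contr_def)

lemma contr_eq_carrier_iff:
  assumes "hyperideal J S"
  shows "contr J = carrier R \<longleftrightarrow> J = carrier S"
proof
  assume "contr J = carrier R"
  hence "\<one> \<in> contr J"
    by simp
  thus "J = carrier S"
    using S.hyperideal_one[OF assms] phi(3) by (simp add: contr_def)
qed (use phi(2) in \<open>auto simp: contr_def\<close>)

lemma phi_nat_pow: "x \<in> carrier R \<Longrightarrow> \<phi> (x [^] n) = \<phi> x [^]\<^bsub>S\<^esub> (n::nat)"
  by (induction n) (simp_all add: phi)

lemma hyperradical_contr:
  assumes J: "hyperideal J S" and z: "z \<in> carrier S"
    and a: "a \<in> carrier R" "s \<in> carrier R" "s \<notin> P" "z \<otimes>\<^bsub>S\<^esub> \<phi> s = \<phi> a"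
  shows "z \<in> hyperradical S J \<longleftrightarrow> a \<in> hyperradical R (contr J)"
proof -
  have "z [^]\<^bsub>S\<^esub> n \<in> J \<longleftrightarrow> a [^] n \<in> contr J" for n :: nat
  proof (rule mem_iff_contr[OF J])
    show "s [^] n \<notin> P"
      using R.nat_pow_mem_prime[OF prime a(2)] a(3) by blast
    show "z [^]\<^bsub>S\<^esub> n \<otimes>\<^bsub>S\<^esub> \<phi> (s [^] n) = \<phi> (a [^] n)"
      using z a phi(2) S.pow_mult_distrib[OF S.m_comm, of z "\<phi> s" n] by (simp add: phi_nat_pow)
  qed (use z a in auto)
  thus ?thesis
    using z a(1) by (simp add: hyperradical_def)
qed

lemma hyperradical_contr_eq:
  assumes "hyperideal J S"
  shows "hyperradical R (contr J) = contr (hyperradical S J)"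
proof -
  have "a \<in> hyperradical R (contr J) \<longleftrightarrow> a \<in> contr (hyperradical S J)" if "a \<in> carrier R" for a
    using hyperradical_contr[OF assms, of "\<phi> a" a \<one>] that phi(2,3) primeD(4)
    by (simp add: contr_def)
  thus ?thesis
    by (auto simp: contr_def hyperradical_def)
qed

lemma prime_contr_iff:
  assumes J: "hyperideal J S"
  shows "prime_hyperideal (contr J) R \<longleftrightarrow> prime_hyperideal J S"
proof
  assume p: "prime_hyperideal (contr J) R"
  have "z \<in> J \<or> w \<in> J" if zw: "z \<in> carrier S" "w \<in> carrier S" "z \<otimes>\<^bsub>S\<^esub> w \<in> J" for z w
  proof -
    obtain a s where a: "a \<in> carrier R" "s \<in> carrier R" "s \<notin> P" "z \<otimes>\<^bsub>S\<^esub> \<phi> s = \<phi> a"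
      using fractionE[OF zw(1)] .
    obtain b t where b: "b \<in> carrier R" "t \<in> carrier R" "t \<notin> P" "w \<otimes>\<^bsub>S\<^esub> \<phi> t = \<phi> b"
      using fractionE[OF zw(2)] .
    have "a \<otimes> b \<in> contr J"
      using mem_iff_contr[OF J _ _ _ _ fraction_mult[OF zw(1,2) a(1) b(1) a(2) b(2) a(4) b(4)]]
        zw a b denominator_mult by simp
    thus ?thesis
      using R.prime_hyperidealD(5)[OF p a(1) b(1)] mem_iff_contr[OF J zw(1) a]
        mem_iff_contr[OF J zw(2) b] by blast
  qed
  thus "prime_hyperideal J S"
    using p J contr_eq_carrier_iff[OF J] by (auto simp: prime_hyperideal_def)
next
  assume p: "prime_hyperideal J S"
  have "a \<in> contr J \<or> b \<in> contr J" if "a \<in> carrier R" "b \<in> carrier R" "a \<otimes> b \<in> contr J" for a b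
    using that S.prime_hyperidealD(5)[OF p, of "\<phi> a" "\<phi> b"] phi(2,5) by (simp add: contr_def)
  thus "prime_hyperideal (contr J) R"
    using p hyperideal_contr[OF J] contr_eq_carrier_iff[OF J] by (auto simp: prime_hyperideal_def)
qed

lemma hyperideal_ext_P: "hyperideal (ext P) S"
  by (rule hyperideal_ext[OF primeD(1)])

lemma contr_ext_P: "contr (ext P) = P"
  by (rule contr_ext_primary[OF R.prime_mem_primary_hyperideals_of[OF prime]])

lemma prime_ext_P: "prime_hyperideal (ext P) S"
  using prime_contr_iff[OF hyperideal_ext_P] contr_ext_P prime by simp

lemma primary_contr_iff:
  assumes J: "hyperideal J S"
  shows "contr J \<in> primary_hyperideals_of R P \<longleftrightarrow> J \<in> primary_hyperideals_of S (ext P)"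
proof
  assume c: "contr J \<in> primary_hyperideals_of R P"
  hence rad: "hyperradical R (contr J) = P" and p: "primary_hyperideal (contr J) R"
    by (auto simp: primary_hyperideals_of_def)
  have rad_iff: "z \<in> hyperradical S J \<longleftrightarrow> z \<in> ext P" if z: "z \<in> carrier S" for z
  proof -
    obtain a s where a: "a \<in> carrier R" "s \<in> carrier R" "s \<notin> P" "z \<otimes>\<^bsub>S\<^esub> \<phi> s = \<phi> a"
      using fractionE[OF z] .
    show ?thesis
      using hyperradical_contr[OF J z a] mem_iff_contr[OF hyperideal_ext_P z a] rad contr_ext_P
      by simp
  qed
  have "z \<in> J \<or> w \<in> hyperradical S J"
    if zw: "z \<in> carrier S" "w \<in> carrier S" "z \<otimes>\<^bsub>S\<^esub> w \<in> J" for z w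
  proof -
    obtain a s where a: "a \<in> carrier R" "s \<in> carrier R" "s \<notin> P" "z \<otimes>\<^bsub>S\<^esub> \<phi> s = \<phi> a"
      using fractionE[OF zw(1)] .
    obtain b t where b: "b \<in> carrier R" "t \<in> carrier R" "t \<notin> P" "w \<otimes>\<^bsub>S\<^esub> \<phi> t = \<phi> b"
      using fractionE[OF zw(2)] .
    have "a \<otimes> b \<in> contr J"
      using mem_iff_contr[OF J _ _ _ _ fraction_mult[OF zw(1,2) a(1) b(1) a(2) b(2) a(4) b(4)]]
        zw a b denominator_mult by simp
    hence "a \<in> contr J \<or> b \<in> hyperradical R (contr J)"
      using p a b by (simp add: primary_hyperideal_def)
    thus ?thesis
      using mem_iff_contr[OF J zw(1) a] hyperradical_contr[OF J zw(2) b] by blast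
  qed
  moreover have "hyperradical S J = ext P"
  proof -
    have "hyperradical S J \<subseteq> carrier S" "ext P \<subseteq> carrier S"
      by (auto simp: hyperradical_def ext_def)
    thus ?thesis
      using rad_iff by blast
  qed
  ultimately show "J \<in> primary_hyperideals_of S (ext P)"
    using p J contr_eq_carrier_iff[OF J]
    by (auto simp: primary_hyperideals_of_def primary_hyperideal_def)
next
  assume "J \<in> primary_hyperideals_of S (ext P)"
  hence rad: "hyperradical S J = ext P" and p: "primary_hyperideal J S"
    by (auto simp: primary_hyperideals_of_def)
  have rad': "hyperradical R (contr J) = P"
    using hyperradical_contr_eq[OF J] rad contr_ext_P by simp
  have "a \<in> contr J \<or> b \<in> hyperradical R (contr J)"
    if ab: "a \<in> carrier R" "b \<in> carrier R" "a \<otimes> b \<in> contr J" for a b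
  proof -
    have "\<phi> a \<in> J \<or> \<phi> b \<in> hyperradical S J"
      using p ab phi(2,5) by (simp add: primary_hyperideal_def contr_def)
    thus ?thesis
      using ab unfolding hyperradical_contr_eq[OF J] by (simp add: contr_def)
  qed
  thus "contr J \<in> primary_hyperideals_of R P"
    using p rad' hyperideal_contr[OF J] contr_eq_carrier_iff[OF J]
    by (auto simp: primary_hyperideals_of_def primary_hyperideal_def)
qed

lemma primary_hyperideals_of_eq:
  "primary_hyperideals_of R P = contr ` primary_hyperideals_of S (ext P)"
proof
  show "primary_hyperideals_of R P \<subseteq> contr ` primary_hyperideals_of S (ext P)"
  proof
    fix Q assume Q: "Q \<in> primary_hyperideals_of R P"
    hence "hyperideal (ext Q) S"
      by (intro hyperideal_ext) (simp add: primary_hyperideals_of_def primary_hyperideal_def)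
    thus "Q \<in> contr ` primary_hyperideals_of S (ext P)"
      using primary_contr_iff[of "ext Q"] contr_ext_primary[OF Q] Q by force
  qed
  show "contr ` primary_hyperideals_of S (ext P) \<subseteq> primary_hyperideals_of R P"
  proof (rule image_subsetI)
    fix J assume J: "J \<in> primary_hyperideals_of S (ext P)"
    hence "hyperideal J S"
      by (simp add: primary_hyperideals_of_def primary_hyperideal_def)
    thus "contr J \<in> primary_hyperideals_of R P"
      using primary_contr_iff J by blast
  qed
qed

lemma local_localization: "local_hyperring S"
proof -
  have sub: "I \<subseteq> ext P" if I: "hyperideal I S" "I \<noteq> carrier S" for I
  proof
    fix z assume z: "z \<in> I"
    hence zc: "z \<in> carrier S"
      using S.hyperidealD(1)[OF I(1)] by blast
    obtain a s where a: "a \<in> carrier R" "s \<in> carrier R" "s \<notin> P" "z \<otimes>\<^bsub>S\<^esub> \<phi> s = \<phi> a"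
      using fractionE[OF zc] .
    show "z \<in> ext P"
    proof (rule ccontr)
      assume "z \<notin> ext P"
      hence "a \<notin> P"
        using mem_iff_contr[OF hyperideal_ext_P zc a] contr_ext_P by simp
      then obtain u where u: "u \<in> carrier S" "\<phi> a \<otimes>\<^bsub>S\<^esub> u = \<one>\<^bsub>S\<^esub>"
        using unit[of a] a(1) by auto
      have "\<phi> a \<in> I"
        using mem_iff_contr[OF I(1) zc a] z by (simp add: contr_def)
      hence "\<one>\<^bsub>S\<^esub> \<in> I"
        using S.hyperidealD(3)[OF I(1), of "\<phi> a" u] u by simp
      thus False
        using S.hyperideal_one I by blast
    qed
  qed
  have ne: "ext P \<noteq> carrier S"
    using prime_ext_P by (simp add: prime_hyperideal_def)
  have "maximal_hyperideal M S \<longleftrightarrow> M = ext P" for M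
    using sub ne hyperideal_ext_P unfolding maximal_hyperideal_def by blast
  thus ?thesis
    using S.krasner_hyperring_axioms by (simp add: local_hyperring_def)
qed

lemma chain_and_prime_Inter_iff:
  defines "\<Delta> \<equiv> primary_hyperideals_of R P" and "\<Delta>' \<equiv> primary_hyperideals_of S (ext P)"
  shows "(\<forall>A\<in>\<Delta>. \<forall>B\<in>\<Delta>. A \<subseteq> B \<or> B \<subseteq> A) \<and> prime_hyperideal (\<Inter>Q\<in>\<Delta>. Q) R \<longleftrightarrow>
    (\<forall>A\<in>\<Delta>'. \<forall>B\<in>\<Delta>'. A \<subseteq> B \<or> B \<subseteq> A) \<and> prime_hyperideal (\<Inter>Q\<in>\<Delta>'. Q) S"
proof -
  have \<Delta>: "\<Delta> = contr ` \<Delta>'"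
    unfolding \<Delta>_def \<Delta>'_def by (rule primary_hyperideals_of_eq)
  have ideal: "\<And>J. J \<in> \<Delta>' \<Longrightarrow> hyperideal J S"
    by (simp add: \<Delta>'_def primary_hyperideals_of_def primary_hyperideal_def)
  have ne: "\<Delta>' \<noteq> {}"
    using S.prime_mem_primary_hyperideals_of[OF prime_ext_P] by (auto simp: \<Delta>'_def)
  have "(\<Inter>Q\<in>\<Delta>. Q) = contr (\<Inter>Q\<in>\<Delta>'. Q)"
    using ne by (auto simp: \<Delta> contr_def)
  hence "prime_hyperideal (\<Inter>Q\<in>\<Delta>. Q) R \<longleftrightarrow> prime_hyperideal (\<Inter>Q\<in>\<Delta>'. Q) S"
    using prime_contr_iff[OF S.hyperideal_Inter[OF ideal ne]] by simp
  moreover have "(\<forall>A\<in>\<Delta>. \<forall>B\<in>\<Delta>. A \<subseteq> B \<or> B \<subseteq> A) \<longleftrightarrow> (\<forall>A\<in>\<Delta>'. \<forall>B\<in>\<Delta>'. A \<subseteq> B \<or> B \<subseteq> A)"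
    using contr_mono_iff[OF ideal ideal] by (simp add: \<Delta>)
  ultimately show ?thesis
    by simp
qed

section \<open>Hypervaluation hyperideals under localization\<close>

text \<open>
  The isomorphism \<open>a / b \<mapsto> \<phi> a / \<phi> b\<close> from the quotient hyperfield of \<open>R\<close> to that of \<open>S\<close>. The union over
  all representatives of a class equals the value at any one of them (\<open>frac_map_hfrac\<close>).
\<close>

definition frac_map :: "('a \<times> 'a) set \<Rightarrow> ('b \<times> 'b) set"
  where "frac_map X = (\<Union>(a, b)\<in>X. hfrac S (\<phi> a) (\<phi> b))"

lemma phi_denom: "b \<in> carrier R - {\<zero>\<^sub>h} \<Longrightarrow> \<phi> b \<in> carrier S - {\<zero>\<^sub>h\<^bsub>S\<^esub>}"
  using phi(2)[of b] phi_eq_iff[of b "\<zero>\<^sub>h"] R.hzero_closed phi(4) by auto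

lemma frac_map_hfrac:
  assumes a: "a \<in> carrier R" and b: "b \<in> carrier R - {\<zero>\<^sub>h}"
  shows "frac_map (hfrac R a b) = hfrac S (\<phi> a) (\<phi> b)"
proof -
  have eq: "hfrac S (\<phi> a') (\<phi> b') = hfrac S (\<phi> a) (\<phi> b)" if "(a', b') \<in> hfrac R a b" for a' b'
  proof -
    have m: "a' \<in> carrier R" "b' \<in> carrier R - {\<zero>\<^sub>h}" "a \<otimes> b' = b \<otimes> a'"
      using that by (auto simp: R.mem_hfrac)
    have "\<phi> a' \<otimes>\<^bsub>S\<^esub> \<phi> b = \<phi> (b \<otimes> a')"
      using m(1) b R.m_comm[of b a'] by (simp add: phi(5))
    also have "\<dots> = \<phi> b' \<otimes>\<^bsub>S\<^esub> \<phi> a"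
      unfolding m(3)[symmetric] using m(2) a R.m_comm[of a b'] by (simp add: phi(5))
    finally show ?thesis
      using S.hfrac_eq_iff[OF phi(2)[OF m(1)] phi_denom[OF m(2)] phi(2)[OF a] phi_denom[OF b]] by simp
  qed
  have "frac_map (hfrac R a b) = (\<Union>q\<in>hfrac R a b. hfrac S (\<phi> a) (\<phi> b))"
    unfolding frac_map_def
  proof (rule SUP_cong[OF refl])
    fix q assume "q \<in> hfrac R a b"
    thus "(case q of (a', b') \<Rightarrow> hfrac S (\<phi> a') (\<phi> b')) = hfrac S (\<phi> a) (\<phi> b)"
      by (cases q) (simp add: eq)
  qed
  thus ?thesis
    using R.self_mem_hfrac[OF a b] by (simp only: UN_constant) (auto split: if_splits)
qed

lemma frac_map_embedding: "hyperring_embedding frac_map R.K S.K"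
proof -
  have inj: "inj_on frac_map (carrier R.K)"
  proof (rule inj_onI)
    fix X Y assume XY: "X \<in> carrier R.K" "Y \<in> carrier R.K" "frac_map X = frac_map Y"
    obtain a b d where fr: "a \<in> carrier R" "b \<in> carrier R" "d \<in> carrier R - {\<zero>\<^sub>h}"
      "X = hfrac R a d" "Y = hfrac R b d"
      by (rule R.common_denominator2[OF XY(1,2)])
    have "\<phi> a = \<phi> b"
      using S.hfrac_inj[OF phi(2)[OF fr(1)] phi(2)[OF fr(2)] phi_denom[OF fr(3)]] XY(3) fr
      by (simp add: frac_map_hfrac)
    thus "X = Y"
      using fr phi_eq_iff by simp
  qed
  have closed: "frac_map ` carrier R.K \<subseteq> carrier S.K"
  proof (rule image_subsetI)
    fix X assume "X \<in> carrier R.K"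
    then obtain a b where ab: "a \<in> carrier R" "b \<in> carrier R - {\<zero>\<^sub>h}" "X = hfrac R a b"
      by (rule R.carrier_KE)
    show "frac_map X \<in> carrier S.K"
      unfolding ab(3) frac_map_hfrac[OF ab(1,2)]
      by (rule S.hfrac_closed[OF phi(2)[OF ab(1)] phi_denom[OF ab(2)]])
  qed
  have ops: "frac_map (X \<otimes>\<^bsub>R.K\<^esub> Y) = frac_map X \<otimes>\<^bsub>S.K\<^esub> frac_map Y \<and>
      frac_map ` (X \<boxplus>\<^bsub>R.K\<^esub> Y) = frac_map X \<boxplus>\<^bsub>S.K\<^esub> frac_map Y"
    if XY: "X \<in> carrier R.K" "Y \<in> carrier R.K" for X Y
  proof -
    obtain a b d where fr: "a \<in> carrier R" "b \<in> carrier R" "d \<in> carrier R - {\<zero>\<^sub>h}"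
      "X = hfrac R a d" "Y = hfrac R b d"
      by (rule R.common_denominator2[OF XY])
    have dd: "d \<otimes> d \<in> carrier R - {\<zero>\<^sub>h}"
      using R.denom_closed fr(3) by blast
    have S: "\<phi> a \<in> carrier S" "\<phi> b \<in> carrier S" "\<phi> d \<in> carrier S - {\<zero>\<^sub>h\<^bsub>S\<^esub>}"
      using fr phi(2) phi_denom by blast+
    have "frac_map ` (X \<boxplus>\<^bsub>R.K\<^esub> Y) = (\<lambda>x. frac_map (hfrac R x d)) ` (a \<boxplus> b)"
      using fr by (simp add: R.hadd_hfrac_common image_image)
    also have "\<dots> = (\<lambda>x. hfrac S (\<phi> x) (\<phi> d)) ` (a \<boxplus> b)"
      using R.hadd_closed[OF fr(1,2)] fr(3) by (intro image_cong refl frac_map_hfrac) auto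
    also have "\<dots> = (\<lambda>x. hfrac S x (\<phi> d)) ` (\<phi> a \<boxplus>\<^bsub>S\<^esub> \<phi> b)"
      using fr by (simp add: phi(6)[symmetric] image_image)
    also have "\<dots> = frac_map X \<boxplus>\<^bsub>S.K\<^esub> frac_map Y"
      using fr S.hadd_hfrac_common[OF S] by (simp add: frac_map_hfrac)
    moreover have "frac_map (X \<otimes>\<^bsub>R.K\<^esub> Y) = frac_map X \<otimes>\<^bsub>S.K\<^esub> frac_map Y"
      using fr dd S by (simp add: frac_map_hfrac R.mult_hfrac S.mult_hfrac phi(5))
    ultimately show ?thesis
      by simp
  qed
  have "frac_map \<one>\<^bsub>R.K\<^esub> = \<one>\<^bsub>S.K\<^esub>" "frac_map \<zero>\<^sub>h\<^bsub>R.K\<^esub> = \<zero>\<^sub>h\<^bsub>S.K\<^esub>"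
    using R.one_denom R.hzero_closed
    by (simp_all add: R.one_K R.zero_K S.one_K S.zero_K frac_map_hfrac phi(3,4))
  thus ?thesis
    using inj closed ops by (simp add: hyperring_embedding_def)
qed

lemma frac_map_surj: "carrier S.K = frac_map ` carrier R.K"
proof
  show "carrier S.K \<subseteq> frac_map ` carrier R.K"
  proof
    fix Y assume "Y \<in> carrier S.K"
    then obtain z w where zw: "z \<in> carrier S" "w \<in> carrier S - {\<zero>\<^sub>h\<^bsub>S\<^esub>}" "Y = hfrac S z w"
      by (rule S.carrier_KE)
    obtain a s where a: "a \<in> carrier R" "s \<in> carrier R" "s \<notin> P" "z \<otimes>\<^bsub>S\<^esub> \<phi> s = \<phi> a"
      using fractionE[OF zw(1)] .
    have w: "w \<in> carrier S"
      using zw(2) by blast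
    obtain b t where b: "b \<in> carrier R" "t \<in> carrier R" "t \<notin> P" "w \<otimes>\<^bsub>S\<^esub> \<phi> t = \<phi> b"
      using fractionE[OF w] .
    have st: "s \<in> carrier R - {\<zero>\<^sub>h}" "t \<in> carrier R - {\<zero>\<^sub>h}"
      using a b primeD(3) by auto
    have "\<phi> b \<in> carrier S - {\<zero>\<^sub>h\<^bsub>S\<^esub>}"
      using S.denom_closed[OF zw(2) phi_denom[OF st(2)]] unfolding b(4) .
    hence "b \<in> carrier R - {\<zero>\<^sub>h}"
      using b(1) phi(4) by auto
    hence bs: "b \<otimes> s \<in> carrier R - {\<zero>\<^sub>h}"
      using R.denom_closed st(1) by blast
    have "z \<otimes>\<^bsub>S\<^esub> \<phi> (b \<otimes> s) = z \<otimes>\<^bsub>S\<^esub> ((w \<otimes>\<^bsub>S\<^esub> \<phi> t) \<otimes>\<^bsub>S\<^esub> \<phi> s)"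
      using a b by (simp add: phi(5))
    also have "\<dots> = w \<otimes>\<^bsub>S\<^esub> ((z \<otimes>\<^bsub>S\<^esub> \<phi> s) \<otimes>\<^bsub>S\<^esub> \<phi> t)"
      using zw(1) w a(2) b(2) phi(2) by (simp add: S.m_ac)
    also have "\<dots> = w \<otimes>\<^bsub>S\<^esub> \<phi> (a \<otimes> t)"
      using a b by (simp add: phi(5))
    finally have eq: "z \<otimes>\<^bsub>S\<^esub> \<phi> (b \<otimes> s) = w \<otimes>\<^bsub>S\<^esub> \<phi> (a \<otimes> t)" .
    have at: "a \<otimes> t \<in> carrier R"
      using a(1) b(2) by (rule R.m_closed)
    have "Y = frac_map (hfrac R (a \<otimes> t) (b \<otimes> s))"
      unfolding frac_map_hfrac[OF at bs] zw(3)
        S.hfrac_eq_iff[OF zw(1,2) phi(2)[OF at] phi_denom[OF bs]] by (rule eq)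
    thus "Y \<in> frac_map ` carrier R.K"
      using R.hfrac_closed[OF at bs] by (rule image_eqI)
  qed
  show "frac_map ` carrier R.K \<subseteq> carrier S.K"
    using hyperring_embeddingD(2)[OF frac_map_embedding] by blast
qed

lemma frac_map_frac_embed: "a \<in> carrier R \<Longrightarrow> frac_map (frac_embed R a) = frac_embed S (\<phi> a)"
  using R.one_denom by (simp add: frac_embed_def frac_map_hfrac phi(3))

lemma valuation_contraction_frac_embed_iff:
  assumes "I \<subseteq> carrier R"
  shows "valuation_contraction (frac_embed R) R R.K I \<longleftrightarrow>
    valuation_contraction (frac_embed S \<circ> \<phi>) R S.K I"
proof
  let ?g = "inv_into (carrier R.K) frac_map"
  have cl: "frac_embed R x \<in> carrier R.K" if "x \<in> carrier R" for x
    using hyperring_embeddingD(2)[OF R.frac_embed_embedding that] .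
  show "valuation_contraction (frac_embed S \<circ> \<phi>) R S.K I"
    if "valuation_contraction (frac_embed R) R R.K I"
    by (rule valuation_contraction_transport[OF R.proper_hyperdomain_axioms S.proper_hyperdomain_axioms
          frac_map_embedding frac_map_surj _ assms that])
      (simp add: cl frac_map_frac_embed)
  have emb: "hyperring_embedding ?g S.K R.K"
    by (rule hyperring_embedding_inv_into[OF R.krasner_hyperring_quotient frac_map_embedding frac_map_surj])
  have surj: "carrier R.K = ?g ` carrier S.K"
    unfolding frac_map_surj
    using inv_into_image_cancel[OF hyperring_embeddingD(1)[OF frac_map_embedding] subset_refl] by simp
  have g: "(frac_embed S \<circ> \<phi>) x \<in> carrier S.K \<and> ?g ((frac_embed S \<circ> \<phi>) x) = frac_embed R x"
    if "x \<in> carrier R" for x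
    using that cl[OF that] hyperring_embeddingD(1,2)[OF frac_map_embedding]
    by (simp add: frac_map_frac_embed[symmetric])
  show "valuation_contraction (frac_embed R) R R.K I"
    if "valuation_contraction (frac_embed S \<circ> \<phi>) R S.K I"
    by (rule valuation_contraction_transport[OF S.proper_hyperdomain_axioms R.proper_hyperdomain_axioms
          emb surj g assms that])
qed

text \<open>
  A hypervaluation hyperring \<open>V\<close> that contains \<open>R\<close> need not contain \<open>S\<close>, so \<open>V\<close> and its hyperideal \<open>I\<close>
  are themselves localized at the complement of \<open>P\<close>. The localization of \<open>V\<close> contains \<open>V\<close> and is
  therefore again a hypervaluation hyperring. That the localization of \<open>I\<close> contracts to \<open>J\<close> and to nothing
  larger uses that \<open>contr J\<close> is \<open>P\<close>-primary.
\<close>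

lemma valuation_contraction_ext:
  assumes J: "J \<in> primary_hyperideals_of S (ext P)"
    and val: "valuation_contraction (frac_embed S \<circ> \<phi>) R S.K (contr J)"
  shows "valuation_contraction (frac_embed S) S S.K J"
proof -
  let ?i = "frac_embed S"
  define \<psi> where "\<psi> = ?i \<circ> \<phi>"
  interpret K: krasner_hyperring S.K
    by (rule S.krasner_hyperring_quotient)
  note i = hyperring_embeddingD[OF S.frac_embed_embedding]
  have emb: "hyperring_embedding \<psi> R S.K"
    unfolding \<psi>_def by (rule hyperring_embedding_comp[OF embedding S.frac_embed_embedding])
  note psi = hyperring_embeddingD[OF emb]
  have Ji: "hyperideal J S"
    using J by (simp add: primary_hyperideals_of_def primary_hyperideal_def)
  have Q: "primary_hyperideal (contr J) R" "hyperradical R (contr J) = P"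
    using primary_contr_iff[OF Ji] J by (auto simp: primary_hyperideals_of_def)
  have i_frac: "?i z \<otimes>\<^bsub>S.K\<^esub> \<psi> s = \<psi> a"
    if "z \<in> carrier S" "s \<in> carrier R" "z \<otimes>\<^bsub>S\<^esub> \<phi> s = \<phi> a" for z s a
    using that i(5)[of z "\<phi> s"] phi(2) by (simp add: \<psi>_def)
  obtain V I where hV: "hypervaluation_hyperring V S.K" and RV: "\<psi> ` carrier R \<subseteq> V"
    and I: "hyperideal I (S.K\<lparr>carrier := V\<rparr>)" and QI: "\<psi> ` contr J = I \<inter> \<psi> ` carrier R"
    using val unfolding valuation_contraction_def \<psi>_def[symmetric] by (elim exE conjE) (rule that)
  have "subhyperring V S.K"
    using hV by (simp add: hypervaluation_hyperring_def)
  hence VK: "V \<subseteq> carrier S.K" and V0: "\<zero>\<^sub>h\<^bsub>S.K\<^esub> \<in> V" "\<one>\<^bsub>S.K\<^esub> \<in> V" "\<ominus>\<^sub>h\<^bsub>S.K\<^esub> \<one>\<^bsub>S.K\<^esub> \<in> V"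
    and Vm: "\<And>x y. \<lbrakk>x \<in> V; y \<in> V\<rbrakk> \<Longrightarrow> x \<otimes>\<^bsub>S.K\<^esub> y \<in> V"
    and Va: "\<And>x y. \<lbrakk>x \<in> V; y \<in> V\<rbrakk> \<Longrightarrow> x \<boxplus>\<^bsub>S.K\<^esub> y \<subseteq> V"
    by (auto simp: K.subhyperring_iff)
  interpret V: krasner_hyperring "S.K\<lparr>carrier := V\<rparr>"
    using \<open>subhyperring V S.K\<close> by (simp add: subhyperring_def)
  note I' = V.hyperidealD[OF I, simplified]
  have psiV: "\<psi> s \<in> V" if "s \<in> carrier R" for s
    using that RV by blast

  \<comment> \<open>The elements of the quotient hyperfield that some denominator outside \<open>P\<close> carries into \<open>A\<close>.\<close>
  define loc where "loc A = {x \<in> carrier S.K. \<exists>s\<in>carrier R - P. x \<otimes>\<^bsub>S.K\<^esub> \<psi> s \<in> A}" for A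
  have locI: "x \<in> loc A"
    if "x \<in> carrier S.K" "s \<in> carrier R" "s \<notin> P" "x \<otimes>\<^bsub>S.K\<^esub> \<psi> s \<in> A" for x s A
    using that unfolding loc_def by blast
  have loc_sub: "A \<subseteq> loc A" if "A \<subseteq> carrier S.K" for A
  proof
    fix x assume x: "x \<in> A"
    hence "x \<otimes>\<^bsub>S.K\<^esub> \<psi> \<one> \<in> A" "x \<in> carrier S.K"
      using that by (auto simp: psi(3))
    thus "x \<in> loc A"
      using primeD(4) R.one_closed unfolding loc_def by blast
  qed
  have loc_mult: "x \<otimes>\<^bsub>S.K\<^esub> y \<in> loc A"
    if xy: "x \<in> loc A" "y \<in> loc V" and A: "\<And>x y. \<lbrakk>x \<in> A; y \<in> V\<rbrakk> \<Longrightarrow> x \<otimes>\<^bsub>S.K\<^esub> y \<in> A" for A x y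
  proof -
    obtain s where s: "x \<in> carrier S.K" "s \<in> carrier R" "s \<notin> P" "x \<otimes>\<^bsub>S.K\<^esub> \<psi> s \<in> A"
      using xy(1) by (auto simp: loc_def)
    obtain t where t: "y \<in> carrier S.K" "t \<in> carrier R" "t \<notin> P" "y \<otimes>\<^bsub>S.K\<^esub> \<psi> t \<in> V"
      using xy(2) by (auto simp: loc_def)
    have "(x \<otimes>\<^bsub>S.K\<^esub> y) \<otimes>\<^bsub>S.K\<^esub> \<psi> (s \<otimes> t) = (x \<otimes>\<^bsub>S.K\<^esub> \<psi> s) \<otimes>\<^bsub>S.K\<^esub> (y \<otimes>\<^bsub>S.K\<^esub> \<psi> t)"
      using s(1,2) t(1,2) psi(2) by (simp add: psi(5) K.m_ac)
    hence "(x \<otimes>\<^bsub>S.K\<^esub> y) \<otimes>\<^bsub>S.K\<^esub> \<psi> (s \<otimes> t) \<in> A"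
      using A[OF s(4) t(4)] by simp
    moreover have "s \<otimes> t \<in> carrier R - P" "x \<otimes>\<^bsub>S.K\<^esub> y \<in> carrier S.K"
      using s t denominator_mult by auto
    ultimately show ?thesis
      unfolding loc_def by blast
  qed
  have loc_add: "x \<boxplus>\<^bsub>S.K\<^esub> y \<subseteq> loc A"
    if xy: "x \<in> loc A" "y \<in> loc A"
      and A: "\<And>x y. \<lbrakk>x \<in> A; y \<in> V\<rbrakk> \<Longrightarrow> x \<otimes>\<^bsub>S.K\<^esub> y \<in> A" "\<And>x y. \<lbrakk>x \<in> A; y \<in> A\<rbrakk> \<Longrightarrow> x \<boxplus>\<^bsub>S.K\<^esub> y \<subseteq> A"
    for A x y
  proof
    fix u assume u: "u \<in> x \<boxplus>\<^bsub>S.K\<^esub> y"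
    obtain s where s: "x \<in> carrier S.K" "s \<in> carrier R" "s \<notin> P" "x \<otimes>\<^bsub>S.K\<^esub> \<psi> s \<in> A"
      using xy(1) by (auto simp: loc_def)
    obtain t where t: "y \<in> carrier S.K" "t \<in> carrier R" "t \<notin> P" "y \<otimes>\<^bsub>S.K\<^esub> \<psi> t \<in> A"
      using xy(2) by (auto simp: loc_def)
    have uc: "u \<in> carrier S.K"
      using u K.hadd_closed[OF s(1) t(1)] by blast
    have c: "\<psi> (s \<otimes> t) \<in> carrier S.K"
      using s t psi(2) by simp
    have "\<psi> (s \<otimes> t) \<otimes>\<^bsub>S.K\<^esub> x = (x \<otimes>\<^bsub>S.K\<^esub> \<psi> s) \<otimes>\<^bsub>S.K\<^esub> \<psi> t"
      using s(1,2) t(2) psi(2) by (simp add: psi(5) K.m_ac)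
    hence x: "\<psi> (s \<otimes> t) \<otimes>\<^bsub>S.K\<^esub> x \<in> A"
      using A(1)[OF s(4) psiV[OF t(2)]] by simp
    have "\<psi> (s \<otimes> t) \<otimes>\<^bsub>S.K\<^esub> y = (y \<otimes>\<^bsub>S.K\<^esub> \<psi> t) \<otimes>\<^bsub>S.K\<^esub> \<psi> s"
      using t(1,2) s(2) psi(2) by (simp add: psi(5) K.m_ac)
    hence y: "\<psi> (s \<otimes> t) \<otimes>\<^bsub>S.K\<^esub> y \<in> A"
      using A(1)[OF t(4) psiV[OF s(2)]] by simp
    have "\<psi> (s \<otimes> t) \<otimes>\<^bsub>S.K\<^esub> u \<in> (\<lambda>v. \<psi> (s \<otimes> t) \<otimes>\<^bsub>S.K\<^esub> v) ` (x \<boxplus>\<^bsub>S.K\<^esub> y)"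
      using u by blast
    hence "u \<otimes>\<^bsub>S.K\<^esub> \<psi> (s \<otimes> t) \<in> A"
      unfolding K.m_comm[OF uc c] using A(2)[OF x y] K.distrib[OF c s(1) t(1)] by auto
    moreover have "s \<otimes> t \<in> carrier R - P"
      using s t denominator_mult by auto
    ultimately show "u \<in> loc A"
      using uc unfolding loc_def by blast
  qed

  have "subhyperring (loc V) S.K"
    unfolding K.subhyperring_iff
    using loc_sub[OF VK] V0 loc_mult[of _ V] loc_add[of _ V] Vm Va by (auto simp: loc_def)
  then interpret W: krasner_hyperring "S.K\<lparr>carrier := loc V\<rparr>"
    by (simp add: subhyperring_def)
  have "hypervaluation_hyperring (loc V) S.K"
    using hV \<open>subhyperring (loc V) S.K\<close> loc_sub[OF VK]
    by (auto simp: hypervaluation_hyperring_def)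
  moreover have "?i ` carrier S \<subseteq> loc V"
  proof
    fix x assume "x \<in> ?i ` carrier S"
    then obtain z where z: "z \<in> carrier S" "x = ?i z"
      by blast
    obtain a s where a: "a \<in> carrier R" "s \<in> carrier R" "s \<notin> P" "z \<otimes>\<^bsub>S\<^esub> \<phi> s = \<phi> a"
      using fractionE[OF z(1)] .
    show "x \<in> loc V"
      unfolding z(2) using i_frac[OF z(1) a(2,4)] psiV[OF a(1)] by (intro locI[OF i(2)[OF z(1)] a(2,3)]) simp
  qed
  moreover have "hyperideal (loc I) (S.K\<lparr>carrier := loc V\<rparr>)"
  proof -
    have "loc I \<subseteq> loc V"
      using I'(1) by (auto simp: loc_def)
    moreover have "loc I \<noteq> {}"
      using loc_sub[of I] I'(1,4) VK by auto
    ultimately show ?thesis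
      unfolding W.hyperideal_iff using loc_mult[of _ I] loc_add[of _ I] I'(2,3) by simp
  qed
  moreover have "?i ` J = loc I \<inter> ?i ` carrier S"
  proof -
    have "?i z \<in> loc I \<longleftrightarrow> z \<in> J" if z: "z \<in> carrier S" for z
    proof -
      obtain a t where a: "a \<in> carrier R" "t \<in> carrier R" "t \<notin> P" "z \<otimes>\<^bsub>S\<^esub> \<phi> t = \<phi> a"
        using fractionE[OF z] .
      have zt: "?i z \<otimes>\<^bsub>S.K\<^esub> \<psi> t = \<psi> a"
        by (rule i_frac[OF z a(2,4)])
      have iz: "?i z \<in> carrier S.K"
        by (rule i(2)[OF z])
      have psi_mem: "b \<in> contr J" if "b \<in> carrier R" "\<psi> b \<in> I" for b
      proof -
        have "\<psi> b \<in> \<psi> ` contr J"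
          using that QI by blast
        thus ?thesis
          using that(1) inj_on_image_mem_iff[OF psi(1) that(1), of "contr J"] by (auto simp: contr_def)
      qed
      have "?i z \<in> loc I \<longleftrightarrow> a \<in> contr J"
      proof
        assume "?i z \<in> loc I"
        then obtain s where s: "s \<in> carrier R" "s \<notin> P" "?i z \<otimes>\<^bsub>S.K\<^esub> \<psi> s \<in> I"
          by (auto simp: loc_def)
        have "\<psi> (a \<otimes> s) = (?i z \<otimes>\<^bsub>S.K\<^esub> \<psi> s) \<otimes>\<^bsub>S.K\<^esub> \<psi> t"
          using iz s(1) a(1,2) psi(2) by (simp add: psi(5) zt[symmetric] K.m_ac)
        \<comment> \<open>As \<open>contr J\<close> is \<open>P\<close>-primary, the factor \<open>s \<notin> P\<close> can be cancelled.\<close>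
        hence "a \<otimes> s \<in> contr J"
          using I'(3)[OF s(3) psiV[OF a(2)]] psi_mem[of "a \<otimes> s"] a(1) s(1) by simp
        thus "a \<in> contr J"
          using Q a(1) s by (auto simp: primary_hyperideal_def)
      next
        assume "a \<in> contr J"
        hence "\<psi> a \<in> I"
          using QI by blast
        thus "?i z \<in> loc I"
          using zt by (intro locI[OF iz a(2,3)]) simp
      qed
      thus ?thesis
        using mem_iff_contr[OF Ji z a] by simp
    qed
    thus ?thesis
      using S.hyperidealD(1)[OF Ji] by auto
  qed
  ultimately show ?thesis
    unfolding valuation_contraction_def by (intro exI conjI)
qed

lemma valuation_contraction_contr:
  assumes J: "hyperideal J S" and val: "valuation_contraction (frac_embed S) S S.K J"
  shows "valuation_contraction (frac_embed S \<circ> \<phi>) R S.K (contr J)"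
proof -
  let ?i = "frac_embed S"
  note i = hyperring_embeddingD[OF S.frac_embed_embedding]
  obtain V I where V: "hypervaluation_hyperring V S.K" "?i ` carrier S \<subseteq> V"
    "hyperideal I (S.K\<lparr>carrier := V\<rparr>)" and JI: "?i ` J = I \<inter> ?i ` carrier S"
    using val unfolding valuation_contraction_def by (elim exE conjE) (rule that)
  have "?i (\<phi> a) \<in> I \<longleftrightarrow> \<phi> a \<in> J" if "a \<in> carrier R" for a
    using JI phi(2)[OF that] inj_on_image_mem_iff[OF i(1) phi(2)[OF that] S.hyperidealD(1)[OF J]]
    by blast
  hence "(?i \<circ> \<phi>) ` contr J = I \<inter> (?i \<circ> \<phi>) ` carrier R"
    by (auto simp: contr_def)
  moreover have "(?i \<circ> \<phi>) ` carrier R \<subseteq> V"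
    using V(2) phi(2) by auto
  ultimately show ?thesis
    unfolding valuation_contraction_def using V(1,3) by (intro exI conjI)
qed

lemma contr_hypervaluation_iff:
  assumes "J \<in> primary_hyperideals_of S (ext P)"
  shows "contr J \<in> hypervaluation_hyperideals R \<longleftrightarrow> J \<in> hypervaluation_hyperideals S"
proof -
  have J: "hyperideal J S"
    using assms by (simp add: primary_hyperideals_of_def primary_hyperideal_def)
  have "contr J \<subseteq> carrier R"
    by (auto simp: contr_def)
  thus ?thesis
    using valuation_contraction_ext[OF assms] valuation_contraction_contr[OF J] hyperideal_contr[OF J] J
      valuation_contraction_frac_embed_iff
    by (auto simp: hypervaluation_hyperideals_def hypervaluation_hyperideal_iff)
qed

lemma assertion_E_iff: "assertion_E R P \<longleftrightarrow> assertion_E S (ext P)"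
proof -
  have "primary_hyperideals_of R P \<subseteq> hypervaluation_hyperideals R \<longleftrightarrow>
      primary_hyperideals_of S (ext P) \<subseteq> hypervaluation_hyperideals S"
    using contr_hypervaluation_iff by (auto simp: primary_hyperideals_of_eq)
  thus ?thesis
    unfolding assertion_E_def Let_def using chain_and_prime_Inter_iff by simp
qed

end

section \<open>Realizing the localization on the same type\<close>

lemma (in proper_hyperdomain) subhyperring_localization:
  assumes P: "prime_hyperideal P R"
  shows "subhyperring {hfrac R a s | a s. a \<in> carrier R \<and> s \<in> carrier R - P} K" (is "subhyperring ?L K")
proof -
  interpret K: krasner_hyperring K
    by (rule krasner_hyperring_quotient)
  note P' = prime_hyperidealD[OF P]
  have den: "s \<in> carrier R - {\<zero>\<^sub>h}" if "s \<in> carrier R - P" for s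
    using that P'(3) by auto
  have mult: "s \<otimes> t \<in> carrier R - P" if "s \<in> carrier R - P" "t \<in> carrier R - P" for s t
    using that P'(5) by auto
  have emb: "frac_embed R a \<in> ?L" if "a \<in> carrier R" for a
    using that P'(4) one_closed unfolding frac_embed_def by blast
  have opp: "\<ominus>\<^sub>h\<^bsub>K\<^esub> \<one>\<^bsub>K\<^esub> = frac_embed R (\<ominus>\<^sub>h \<one>)"
  proof -
    note i = hyperring_embeddingD[OF frac_embed_embedding]
    have "frac_embed R \<zero>\<^sub>h \<in> frac_embed R ` (\<one> \<boxplus> \<ominus>\<^sub>h \<one>)"
      using hadd_hopp[OF one_closed] by blast
    hence "\<zero>\<^sub>h\<^bsub>K\<^esub> \<in> \<one>\<^bsub>K\<^esub> \<boxplus>\<^bsub>K\<^esub> frac_embed R (\<ominus>\<^sub>h \<one>)"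
      unfolding i(6)[OF one_closed hopp_closed[OF one_closed]] i(3,4) .
    thus ?thesis
      using K.hopp_unique[OF K.one_closed i(2)[OF hopp_closed[OF one_closed]]] by simp
  qed
  have ops: "X \<otimes>\<^bsub>K\<^esub> Y \<in> ?L \<and> X \<boxplus>\<^bsub>K\<^esub> Y \<subseteq> ?L" if XY: "X \<in> ?L" "Y \<in> ?L" for X Y
  proof -
    obtain a s where X: "a \<in> carrier R" "s \<in> carrier R - P" "X = hfrac R a s"
      using XY(1) by blast
    obtain b t where Y: "b \<in> carrier R" "t \<in> carrier R - P" "Y = hfrac R b t"
      using XY(2) by blast
    have c: "a \<otimes> t \<boxplus> s \<otimes> b \<subseteq> carrier R" "a \<otimes> b \<in> carrier R"
      using X(1,2) Y(1,2) hadd_closed[of "a \<otimes> t" "s \<otimes> b"] by auto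
    show ?thesis
      unfolding X(3) Y(3) mult_hfrac[OF X(1) den[OF X(2)] Y(1) den[OF Y(2)]]
        hadd_hfrac[OF X(1) den[OF X(2)] Y(1) den[OF Y(2)]]
      using c mult[OF X(2) Y(2)] by blast
  qed
  have "?L \<subseteq> carrier K"
    using hfrac_closed den by blast
  moreover have "\<zero>\<^sub>h\<^bsub>K\<^esub> \<in> ?L" "\<one>\<^bsub>K\<^esub> \<in> ?L" "\<ominus>\<^sub>h\<^bsub>K\<^esub> \<one>\<^bsub>K\<^esub> \<in> ?L"
    using emb[OF hzero_closed] emb[OF one_closed] emb[OF hopp_closed[OF one_closed]]
    unfolding opp unfolding one_K zero_K frac_embed_def .
  ultimately show ?thesis
    using ops by (simp only: K.subhyperring_iff) simp
qed

text \<open>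
  In a finite hyperdomain multiplication by a nonzero element is injective, hence surjective; so every
  nonzero element is a unit and \<open>{\<zero>\<^sub>h}\<close> is the only maximal hyperideal.
\<close>

lemma (in krasner_hyperdomain) local_if_finite:
  assumes fin: "finite (carrier R)" and ne: "\<one> \<noteq> \<zero>\<^sub>h"
  shows "local_hyperring R"
proof -
  have unit: "\<exists>y\<in>carrier R. x \<otimes> y = \<one>" if x: "x \<in> carrier R" "x \<noteq> \<zero>\<^sub>h" for x
  proof -
    have "inj_on (\<lambda>y. x \<otimes> y) (carrier R)"
      using hyperdomain_cancel[OF x] by (auto simp: inj_on_def)
    moreover have "(\<lambda>y. x \<otimes> y) ` carrier R \<subseteq> carrier R"
      using x by auto
    ultimately have "(\<lambda>y. x \<otimes> y) ` carrier R = carrier R"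
      using fin by (rule_tac endo_inj_surj) auto
    thus ?thesis
      using one_closed by (metis imageE)
  qed
  have zero: "hyperideal {\<zero>\<^sub>h} R"
    using hzero_closed hadd_hzero[OF hzero_closed] mult_hzero m_comm
    by (auto simp: hyperideal_iff)
  have proper: "I = {\<zero>\<^sub>h}" if I: "hyperideal I R" "I \<noteq> carrier R" for I
  proof -
    have "x = \<zero>\<^sub>h" if x: "x \<in> I" for x
    proof (rule ccontr)
      assume "x \<noteq> \<zero>\<^sub>h"
      then obtain y where "y \<in> carrier R" "x \<otimes> y = \<one>"
        using unit hyperidealD(1)[OF I(1)] x by blast
      hence "\<one> \<in> I"
        using hyperidealD(3)[OF I(1) x] by metis
      thus False
        using hyperideal_one I by blast
    qed
    thus ?thesis
      using hyperidealD(4)[OF I(1)] by blast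
  qed
  have "{\<zero>\<^sub>h} \<noteq> carrier R"
    using one_closed ne by blast
  hence "maximal_hyperideal M R \<longleftrightarrow> M = {\<zero>\<^sub>h}" for M
    using zero proper unfolding maximal_hyperideal_def by blast
  thus ?thesis
    using krasner_hyperring_axioms by (simp add: local_hyperring_def)
qed

text \<open>
  The localization at \<open>P\<close> is a subhyperring of the quotient hyperfield, whose elements are sets of pairs.
  For infinite \<open>R\<close> the carrier \<open>R\<close> is equipotent to \<open>R \<times> R\<close>, so fractions can be coded injectively by
  elements of \<open>R\<close>, and the structure is transported to the original type.
\<close>

lemma localization_exists:
  fixes R :: "'a hyperring"
  assumes R: "krasner_hyperdomain R" and P: "prime_hyperideal P R" and inf: "infinite (carrier R)"
  obtains S :: "'a hyperring" and \<phi> where "hyper_localization R S \<phi> P"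
proof -
  interpret krasner_hyperdomain R by fact
  interpret proper_hyperdomain R
    by (rule proper_hyperdomain_if_prime[OF P])
  interpret K: krasner_hyperdomain K
    by (rule krasner_hyperdomain_quotient)
  note P' = prime_hyperidealD[OF P]
  define L where "L = {hfrac R a s | a s. a \<in> carrier R \<and> s \<in> carrier R - P}"
  have sub: "subhyperring L K"
    unfolding L_def by (rule subhyperring_localization[OF P])
  hence LK: "L \<subseteq> carrier K"
    by (simp add: subhyperring_def)
  have dom: "krasner_hyperdomain (K\<lparr>carrier := L\<rparr>)"
    using sub K.integral LK
    by (auto simp: krasner_hyperdomain_def krasner_hyperdomain_axioms_def subhyperring_def)

  obtain p where p: "inj_on p (carrier R \<times> carrier R)" "p ` (carrier R \<times> carrier R) = carrier R"
    using card_of_Times_same_infinite[OF inf] card_of_ordIso[of "carrier R \<times> carrier R" "carrier R"]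
    unfolding bij_betw_def by blast
  \<comment> \<open>A choice of numerator and denominator for each fraction.\<close>
  define h where "h X = (SOME q. q \<in> carrier R \<times> (carrier R - {\<zero>\<^sub>h\<^bsub>R\<^esub>}) \<and> hfrac R (fst q) (snd q) = X)" for X
  have h: "h X \<in> carrier R \<times> (carrier R - {\<zero>\<^sub>h\<^bsub>R\<^esub>}) \<and> hfrac R (fst (h X)) (snd (h X)) = X"
    if X: "X \<in> carrier K" for X
    unfolding h_def
  proof (rule someI_ex)
    obtain a b where "a \<in> carrier R" "b \<in> carrier R - {\<zero>\<^sub>h\<^bsub>R\<^esub>}" "X = hfrac R a b"
      using X by (rule carrier_KE)
    thus "\<exists>q. q \<in> carrier R \<times> (carrier R - {\<zero>\<^sub>h\<^bsub>R\<^esub>}) \<and> hfrac R (fst q) (snd q) = X"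
      by (intro exI[of _ "(a, b)"]) simp
  qed
  define f where "f = p \<circ> h"
  define g where "g = inv_into (carrier K) f"
  have f: "inj_on f (carrier K)"
    unfolding f_def
  proof (rule comp_inj_on)
    show "inj_on h (carrier K)"
      by (rule inj_on_inverseI[of _ "\<lambda>q. hfrac R (fst q) (snd q)"]) (rule conjunct2[OF h])
    have "h ` carrier K \<subseteq> carrier R \<times> carrier R"
    proof (rule image_subsetI)
      fix X assume "X \<in> carrier K"
      from conjunct1[OF h[OF this]] show "h X \<in> carrier R \<times> carrier R"
        by (auto simp: mem_Times_iff)
    qed
    thus "inj_on p (h ` carrier K)"
      by (rule inj_on_subset[OF p(1)])
  qed
  have gf: "g (f X) = X" if "X \<in> carrier K" for X
    unfolding g_def using f that by (rule inv_into_f_f)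

  define S :: "'a hyperring" where "S =
    \<lparr>carrier = f ` L,
     mult = (\<lambda>x y. f (g x \<otimes>\<^bsub>K\<^esub> g y)),
     one = f \<one>\<^bsub>K\<^esub>,
     hzero = f \<zero>\<^sub>h\<^bsub>K\<^esub>,
     hadd = (\<lambda>x y. f ` (g x \<boxplus>\<^bsub>K\<^esub> g y))\<rparr>"
  have emb: "hyperring_embedding f (K\<lparr>carrier := L\<rparr>) S"
    using inj_on_subset[OF f LK] LK gf by (auto simp: hyperring_embedding_def S_def subset_iff)
  have S: "krasner_hyperdomain S"
    by (rule krasner_hyperdomain_image[OF dom emb]) (simp add: S_def)

  have inL: "frac_embed R a \<in> L" if "a \<in> carrier R" for a
    using that P'(4) by (auto simp: frac_embed_def L_def)
  have "hyperring_embedding (frac_embed R) R (K\<lparr>carrier := L\<rparr>)"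
    using frac_embed_embedding inL by (auto simp: hyperring_embedding_def)
  hence emb': "hyperring_embedding (f \<circ> frac_embed R) R S"
    using emb by (rule hyperring_embedding_comp)
  note \<phi> = hyperring_embeddingD[OF emb']
  note f' = hyperring_embeddingD[OF emb, simplified]
  have den: "s \<in> carrier R - {\<zero>\<^sub>h\<^bsub>R\<^esub>}" if "s \<in> carrier R - P" for s
    using that P'(3) by auto
  have "hyper_localization R S (f \<circ> frac_embed R) P"
  proof (intro hyper_localization.intro hyper_localization_axioms.intro P emb')
    show "proper_hyperdomain R" ..
    have "\<one>\<^bsub>S\<^esub> \<noteq> \<zero>\<^sub>h\<^bsub>S\<^esub>"
      using inj_on_eq_iff[OF \<phi>(1) one_closed hzero_closed] one_not_zero unfolding \<phi>(3,4) by simp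
    thus "proper_hyperdomain S"
      using S by (simp add: proper_hyperdomain_def proper_hyperdomain_axioms_def)
    fix s assume s: "s \<in> carrier R - P"
    have "frac_embed R s \<otimes>\<^bsub>K\<^esub> hfrac R \<one>\<^bsub>R\<^esub> s = \<one>\<^bsub>K\<^esub>"
    proof -
      have "hfrac R \<one>\<^bsub>R\<^esub> s \<otimes>\<^bsub>K\<^esub> frac_embed R s = \<one>\<^bsub>K\<^esub>"
        using hfrac_mult_denominator[OF one_closed den[OF s]] by (simp add: frac_embed_def one_K)
      moreover have "frac_embed R s \<in> carrier K"
        using inL s LK by blast
      ultimately show ?thesis
        using K.m_comm[OF hfrac_closed[OF one_closed den[OF s]]] by simp
    qed
    moreover have i: "hfrac R \<one>\<^bsub>R\<^esub> s \<in> L"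
      using s by (auto simp: L_def)
    ultimately have "(f \<circ> frac_embed R) s \<otimes>\<^bsub>S\<^esub> f (hfrac R \<one>\<^bsub>R\<^esub> s) = \<one>\<^bsub>S\<^esub>"
      using f'(5)[of "frac_embed R s" "hfrac R \<one>\<^bsub>R\<^esub> s"] f'(3) inL s by simp
    thus "\<exists>u\<in>carrier S. (f \<circ> frac_embed R) s \<otimes>\<^bsub>S\<^esub> u = \<one>\<^bsub>S\<^esub>"
      using f'(2)[OF i] by blast
  next
    fix z assume "z \<in> carrier S"
    then obtain a s where z: "a \<in> carrier R" "s \<in> carrier R - P" "z = f (hfrac R a s)"
      by (auto simp: S_def L_def)
    have "hfrac R a s \<in> L"
      using z by (auto simp: L_def)
    hence "z \<otimes>\<^bsub>S\<^esub> (f \<circ> frac_embed R) s = (f \<circ> frac_embed R) a"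
      using f'(5)[of "hfrac R a s" "frac_embed R s"] inL[of s] z
        hfrac_mult_denominator[OF z(1) den[OF z(2)]] by simp
    thus "\<exists>a\<in>carrier R. \<exists>s\<in>carrier R - P. z \<otimes>\<^bsub>S\<^esub> (f \<circ> frac_embed R) s = (f \<circ> frac_embed R) a"
      using z by blast
  qed
  thus thesis
    by (rule that)
qed

theorem theorem4p9:
  assumes "\<And>(R :: 'a hyperring) P.
      \<lbrakk>krasner_hyperdomain R; local_hyperring R; prime_hyperideal P R\<rbrakk> \<Longrightarrow> assertion_E R P"
  shows "\<And>(R :: 'a hyperring) P.
      \<lbrakk>krasner_hyperdomain R; prime_hyperideal P R\<rbrakk> \<Longrightarrow> assertion_E R P"
proof -
  fix R :: "'a hyperring" and P
  assume R: "krasner_hyperdomain R" and P: "prime_hyperideal P R"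
  show "assertion_E R P"
  proof (cases "finite (carrier R)")
    case True
    interpret krasner_hyperdomain R by fact
    interpret proper_hyperdomain R
      by (rule proper_hyperdomain_if_prime[OF P])
    show ?thesis
      using assms[OF R local_if_finite[OF True one_not_zero] P] .
  next
    case False
    then obtain S :: "'a hyperring" and \<phi> where "hyper_localization R S \<phi> P"
      by (rule localization_exists[OF R P])
    then interpret hyper_localization R S \<phi> P .
    show ?thesis
      using assms[OF S.krasner_hyperdomain_axioms local_localization prime_ext_P] assertion_E_iff by simp
  qed
qed

end
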